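(* Let $\mathbb{K}$ be a field, $R=\mathbb{K}[X_1,\ldots,X_n]$ the standard graded polynomial ring, $I$ a homogeneous ideal of $R$, and $m\ge 2$ an integer. If $\beta_{i,j}(R/I^{[m]})$ is an extremal Betti number, then $j=ml$ for some $l$, and $\beta_{i,l}(R/I)$ is an extremal Betti number. Conversely, if $\beta_{i,j}(R/I)$ is an extremal Betti number, then $\beta_{i,mj}(R/I^{[m]})$ is an extremal Betti number.
   Context: For $f\in R$ and a positive integer $m$, $f^{[m]}:=f(X_1^m,\ldots,X_n^m)$, and the $m$-th square power of an ideal $I\subset R$ is the ideal $I^{[m]}:=\langle f^{[m]} : f\in I\rangle$ of $R$. The graded Betti numbers are $\beta_{i,j}(R/I)=\dim_{\mathbb{K}}\operatorname{Tor}_i^R(\mathbb{K},R/I)_j$. A nonzero graded Betti number $\beta_{i,j}(R/I)$ is called extremal if $\beta_{k,l}(R/I)=0$ for all pairs $(k,l)\neq(i,j)$ with $k\ge i$ and $l\ge j$. *)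

theory Defs
  imports Complex_Main "HOL-Library.Poly_Mapping"
begin

section \<open>The polynomial ring and its square powers\<close>

text \<open>
  Power products are exponent vectors; a polynomial is a finitely supported family of
  coefficients. The ring \<open>R = K[X_1,...,X_n]\<close> is the type \<open>('n, 'k) mpoly\<close> where
  \<open>'n\<close> is a finite type with \<open>n\<close> elements and \<open>'k\<close> is a field.
\<close>

type_synonym ('n, 'k) mpoly = "('n \<Rightarrow>\<^sub>0 nat) \<Rightarrow>\<^sub>0 'k"

definition Const :: "'k \<Rightarrow> ('n, 'k::field) mpoly" where
  "Const c = Poly_Mapping.single 0 c"

definition Var :: "'n \<Rightarrow> ('n, 'k::field) mpoly" where
  "Var x = Poly_Mapping.single (Poly_Mapping.single x 1) 1"

definition mdeg :: "('n::finite \<Rightarrow>\<^sub>0 nat) \<Rightarrow> nat" where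
  "mdeg t = (\<Sum>x\<in>UNIV. Poly_Mapping.lookup t x)"

definition homogeneous :: "nat \<Rightarrow> ('n::finite, 'k::field) mpoly \<Rightarrow> bool" where
  "homogeneous d f \<longleftrightarrow> (\<forall>t\<in>Poly_Mapping.keys f. mdeg t = d)"

definition ideal_gen :: "('n, 'k::field) mpoly set \<Rightarrow> ('n, 'k) mpoly set" where
  "ideal_gen S = module.span (*) S"

definition homogeneous_ideal :: "('n::finite, 'k::field) mpoly set \<Rightarrow> bool" where
  "homogeneous_ideal I \<longleftrightarrow> (\<exists>S. (\<forall>f\<in>S. \<exists>d. homogeneous d f) \<and> I = ideal_gen S)"

definition subst_power :: "nat \<Rightarrow> ('n::finite, 'k::field) mpoly \<Rightarrow> ('n, 'k) mpoly" where
  "subst_power m f =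
     (\<Sum>t\<in>Poly_Mapping.keys f.
        Const (Poly_Mapping.lookup f t) * (\<Prod>x\<in>UNIV. (Var x ^ m) ^ Poly_Mapping.lookup t x))"

definition square_power :: "nat \<Rightarrow> ('n::finite, 'k::field) mpoly set \<Rightarrow> ('n, 'k) mpoly set" where
  "square_power m I = ideal_gen (subst_power m ` I)"


section \<open>Graded free resolutions of \<open>R/I\<close>\<close>

text \<open>
  The free module with basis \<open>B \<subseteq> \<nat>\<close> consists of the finitely supported families
  of polynomials with support in \<open>B\<close>. Ranks are allowed to be countably infinite; resolutions
  by free modules of finite rank are among those considered.
\<close>

type_synonym ('n, 'k) fvec = "nat \<Rightarrow>\<^sub>0 ('n, 'k) mpoly"

definition smult :: "'a::comm_ring_1 \<Rightarrow> (nat \<Rightarrow>\<^sub>0 'a) \<Rightarrow> (nat \<Rightarrow>\<^sub>0 'a)" where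
  "smult r v = Poly_Mapping.map ((*) r) v"

definition free_on :: "nat set \<Rightarrow> (nat \<Rightarrow>\<^sub>0 'a::zero) set" where
  "free_on B = {v. Poly_Mapping.keys v \<subseteq> B}"

text \<open>Homogeneity of degree \<open>j\<close> in the free module whose \<open>b\<close>-th basis element has degree \<open>d b\<close>:\<close>

definition vhomogeneous :: "(nat \<Rightarrow> int) \<Rightarrow> int \<Rightarrow> ('n::finite, 'k::field) fvec \<Rightarrow> bool" where
  "vhomogeneous d j v \<longleftrightarrow>
     (\<forall>b\<in>Poly_Mapping.keys v. \<forall>t\<in>Poly_Mapping.keys (Poly_Mapping.lookup v b).
        int (mdeg t) + d b = j)"

text \<open>
  \<open>F_i\<close> is the free module on \<open>basis i\<close>, and \<open>bdry i\<close> is the map from \<open>F_(i+1)\<close> to \<open>F_i\<close>.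
  The maps are given on the free module on all of \<open>\<nat>\<close>: a linear map on the submodule \<open>F_i\<close>
  extends by zero on the other basis elements, and only its values on \<open>F_i\<close> are relevant.
  The augmentation from \<open>F_0\<close> onto \<open>R/I\<close> is given by a lift \<open>aug\<close> from \<open>F_0\<close> to \<open>R\<close>, which
  exists because \<open>F_0\<close> is free; its kernel is thus the set of elements sent to \<open>I\<close>.
\<close>

record (overloaded) ('n, 'k) free_complex =
  basis :: "nat \<Rightarrow> nat set"
  bdeg :: "nat \<Rightarrow> nat \<Rightarrow> int"
  bdry :: "nat \<Rightarrow> ('n, 'k) fvec \<Rightarrow> ('n, 'k) fvec"
  aug :: "('n, 'k) fvec \<Rightarrow> ('n, 'k) mpoly"

definition graded_free_resolution ::
  "('n::finite, 'k::field) mpoly set \<Rightarrow> ('n, 'k) free_complex \<Rightarrow> bool" where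
  "graded_free_resolution I F \<longleftrightarrow>
     (\<forall>i. module_hom smult smult (bdry F i)) \<and>
     (\<forall>i j. \<forall>v\<in>free_on (basis F (Suc i)).
        vhomogeneous (bdeg F (Suc i)) j v \<longrightarrow> vhomogeneous (bdeg F i) j (bdry F i v)) \<and>
     module_hom smult (*) (aug F) \<and>
     (\<forall>j. \<forall>v\<in>free_on (basis F 0).
        vhomogeneous (bdeg F 0) j v \<longrightarrow> (\<forall>t\<in>Poly_Mapping.keys (aug F v). int (mdeg t) = j)) \<and>
     (\<forall>r. \<exists>v\<in>free_on (basis F 0). r - aug F v \<in> I) \<and>
     bdry F 0 ` free_on (basis F (Suc 0)) = {v \<in> free_on (basis F 0). aug F v \<in> I} \<and>
     (\<forall>i. bdry F (Suc i) ` free_on (basis F (Suc (Suc i))) =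
          {v \<in> free_on (basis F (Suc i)). bdry F i v = 0})"


section \<open>Graded Betti numbers\<close>

text \<open>
  \<open>K\<close> is the \<open>R\<close>-algebra \<open>R/(X_1,...,X_n)\<close>, so the tensor product of \<open>K\<close> over \<open>R\<close> with the
  free module on \<open>B\<close> is the \<open>K\<close>-vector space on \<open>B\<close>, and the canonical map onto it (tensoring
  with 1) takes constant coefficients. A graded map of free modules induces the unique \<open>K\<close>-linear
  map compatible with these canonical maps, i.e. its matrix is reduced to constant coefficients.
\<close>

definition residue :: "('n, 'k::field) fvec \<Rightarrow> (nat \<Rightarrow>\<^sub>0 'k)" where
  "residue v = Poly_Mapping.map (\<lambda>p. Poly_Mapping.lookup p 0) v"

definition const_vec :: "(nat \<Rightarrow>\<^sub>0 'k::field) \<Rightarrow> ('n, 'k) fvec" where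
  "const_vec v = Poly_Mapping.map Const v"

definition tensor_part :: "('n, 'k::field) free_complex \<Rightarrow> nat \<Rightarrow> int \<Rightarrow> (nat \<Rightarrow>\<^sub>0 'k) set" where
  "tensor_part F i j = free_on {b \<in> basis F i. bdeg F i b = j}"

definition tensor_bdry ::
  "('n, 'k::field) free_complex \<Rightarrow> nat \<Rightarrow> (nat \<Rightarrow>\<^sub>0 'k) \<Rightarrow> (nat \<Rightarrow>\<^sub>0 'k)" where
  "tensor_bdry F i v = residue (bdry F i (const_vec v))"

definition tor_cycles :: "('n, 'k::field) free_complex \<Rightarrow> nat \<Rightarrow> int \<Rightarrow> (nat \<Rightarrow>\<^sub>0 'k) set" where
  "tor_cycles F i j =
     (case i of
        0 \<Rightarrow> tensor_part F 0 j
      | Suc k \<Rightarrow> {v \<in> tensor_part F (Suc k) j. tensor_bdry F k v = 0})"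

definition tor_boundaries :: "('n, 'k::field) free_complex \<Rightarrow> nat \<Rightarrow> int \<Rightarrow> (nat \<Rightarrow>\<^sub>0 'k) set" where
  "tor_boundaries F i j = tensor_bdry F i ` tensor_part F (Suc i) j"

text \<open>
  Dimension of \<open>Z/W\<close> for subspaces \<open>W \<subseteq> Z\<close>: the number of elements of a family in \<open>Z\<close> whose
  classes form a basis of the quotient. As for \<^const>\<open>card\<close>, infinite dimension would give 0,
  but the spaces \<open>Tor_i(K,R/I)_j\<close> below are finite-dimensional.
\<close>

definition quotient_dim :: "(nat \<Rightarrow>\<^sub>0 'k::field) set \<Rightarrow> (nat \<Rightarrow>\<^sub>0 'k) set \<Rightarrow> nat" where
  "quotient_dim Z W =
     card (SOME S. S \<subseteq> Z \<and> \<not> module.dependent smult S \<and>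
                   module.span smult S \<inter> W = {0} \<and> module.span smult (S \<union> W) = Z)"

text \<open>\<open>Tor\<close> does not depend on the choice of the resolution:\<close>

definition betti :: "('n::finite, 'k::field) mpoly set \<Rightarrow> nat \<Rightarrow> int \<Rightarrow> nat" where
  "betti I i j =
     (let F = (SOME F. graded_free_resolution I F)
      in quotient_dim (tor_cycles F i j) (tor_boundaries F i j))"

definition extremal_betti :: "('n::finite, 'k::field) mpoly set \<Rightarrow> nat \<Rightarrow> int \<Rightarrow> bool" where
  "extremal_betti I i j \<longleftrightarrow>
     betti I i j \<noteq> 0 \<and>
     (\<forall>k l. (k, l) \<noteq> (i, j) \<and> k \<ge> i \<and> l \<ge> j \<longrightarrow> betti I k l = 0)"

end

theory Submission
  imports Defs "HOL-Library.Countable"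
begin

text \<open>
  The substitution \<open>X_i \<mapsto> X_i^m\<close> makes \<open>R\<close> a free module over itself. Base change along it therefore
  turns a graded free resolution of \<open>R/I\<close> into one of \<open>R/I^{[m]}\<close> in which all degrees are multiplied
  by \<open>m\<close> and the constant coefficients of the maps are unchanged. Since \<open>Tor\<close> does not depend
  on the resolution, \<open>\<beta>_{i,mj}(R/I^{[m]}) = \<beta>_{i,j}(R/I)\<close>, and \<open>\<beta>_{i,j}(R/I^{[m]})\<close> vanishes if \<open>m\<close> does not
  divide \<open>j\<close>; the claim on extremal Betti numbers is a formal consequence.
\<close>

section \<open>Free modules and graded homomorphisms\<close>

text \<open>\<open>betti\<close> evaluates a resolution picked by \<open>SOME\<close>, so the
  resolutions behind \<open>betti I\<close> and \<open>betti (square_power m I)\<close> need not be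
  related. Base change says something about Betti numbers only once graded resolutions are known to
  exist and Tor is known not to depend on the choice; both are proved here from scratch. Ranks may
  be infinite and no Noetherian argument is made. Accordingly, finite-dimensionality of Tor is never
  established: independence rests on inequalities between cardinalities of complements, which also
  transfer finiteness, and two infinite complements both count as 0. Flatness enters in explicit
  form: a vector is cut into coordinates over the subring of polynomials in the m-th powers, and the
  base-changed map acts on each coordinate as the original map, so kernels and images can be
  compared coordinate by coordinate.\<close>

abbreviation "lookup \<equiv> Poly_Mapping.lookup"
abbreviation "keys \<equiv> Poly_Mapping.keys"
abbreviation "single \<equiv> Poly_Mapping.single"

lemma lookup_map_zero:
  "f 0 = 0 \<Longrightarrow> lookup (Poly_Mapping.map f v) b = f (lookup v b)"
  by (simp add: Poly_Mapping.map.rep_eq when_def)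

lemma lookup_smult [simp]: "lookup (smult r v) b = r * lookup v b"
  by (simp add: smult_def lookup_map_zero)

interpretation fm: module "smult :: 'a::comm_ring_1 \<Rightarrow> (nat \<Rightarrow>\<^sub>0 'a) \<Rightarrow> nat \<Rightarrow>\<^sub>0 'a"
  by unfold_locales (auto intro!: poly_mapping_eqI simp: lookup_add algebra_simps)

interpretation rg: module "(*) :: 'a::comm_ring_1 \<Rightarrow> 'a \<Rightarrow> 'a"
  by unfold_locales (auto simp: algebra_simps)

interpretation vs: vector_space "smult :: 'k::field \<Rightarrow> (nat \<Rightarrow>\<^sub>0 'k) \<Rightarrow> nat \<Rightarrow>\<^sub>0 'k"
  by unfold_locales (auto intro!: poly_mapping_eqI simp: lookup_add algebra_simps)

interpretation vsp: vector_space_pair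
  "smult :: 'k::field \<Rightarrow> (nat \<Rightarrow>\<^sub>0 'k) \<Rightarrow> nat \<Rightarrow>\<^sub>0 'k" "smult :: 'k \<Rightarrow> (nat \<Rightarrow>\<^sub>0 'k) \<Rightarrow> nat \<Rightarrow>\<^sub>0 'k"
  ..

lemma module_hom_smultI:
  fixes D :: "(nat \<Rightarrow>\<^sub>0 'a::comm_ring_1) \<Rightarrow> (nat \<Rightarrow>\<^sub>0 'a)"
  assumes "\<And>v w. D (v + w) = D v + D w" "\<And>r v. D (smult r v) = smult r (D v)"
  shows "module_hom smult smult D"
  using assms by unfold_locales auto

lemma mem_free_on: "v \<in> free_on B \<longleftrightarrow> (\<forall>b. b \<notin> B \<longrightarrow> lookup v b = 0)"
  by (auto simp: free_on_def in_keys_iff)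

lemma subspace_free_on: "fm.subspace (free_on B)"
  by (auto intro!: fm.subspaceI simp: mem_free_on lookup_add)

lemma single_mem_free_on: "b \<in> B \<Longrightarrow> single b p \<in> free_on B"
  by (auto simp: mem_free_on lookup_single when_def)

lemma sum_singles: "(\<Sum>b\<in>keys v. single b (lookup v b)) = v"
  by (rule poly_mapping_eqI)
     (auto simp: lookup_sum lookup_single when_def in_keys_iff sum.delta')

lemma smult_single: "smult r (single b p) = single b (r * p)"
  by (rule poly_mapping_eqI) (auto simp: lookup_single when_def)

definition lin :: "(nat \<Rightarrow> (nat \<Rightarrow>\<^sub>0 'a)) \<Rightarrow> (nat \<Rightarrow>\<^sub>0 'a::comm_ring_1) \<Rightarrow> (nat \<Rightarrow>\<^sub>0 'a)" where
  "lin g v = (\<Sum>b\<in>keys v. smult (lookup v b) (g b))"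

lemma lin_superset:
  assumes "finite A" "keys v \<subseteq> A"
  shows "lin g v = (\<Sum>b\<in>A. smult (lookup v b) (g b))"
  unfolding lin_def using assms
  by (intro sum.mono_neutral_left) (auto simp: in_keys_iff)

lemma lin_single [simp]: "lin g (single b p) = smult p (g b)"
  using lin_superset[of "{b}" "single b p" g] by (auto split: if_splits)

lemma module_hom_lin: "module_hom smult smult (lin g)"
proof (rule module_hom_smultI)
  fix v w :: "nat \<Rightarrow>\<^sub>0 'a" and r :: 'a
  let ?A = "keys v \<union> keys w"
  have "keys (v + w) \<subseteq> ?A" by (rule keys_add)
  then show "lin g (v + w) = lin g v + lin g w"
    by (simp add: lin_superset[of ?A] lookup_add fm.scale_left_distrib sum.distrib)
  have "keys (smult r v) \<subseteq> keys v" by (auto simp: in_keys_iff)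
  then show "lin g (smult r v) = smult r (lin g v)"
    by (simp add: lin_superset[of "keys v"] fm.scale_sum_right)
qed

lemma hom_eq_lin:
  assumes "module_hom smult smult D"
  shows "D v = lin (\<lambda>b. D (single b 1)) v"
proof -
  interpret module_hom smult smult D by fact
  have "D v = D (\<Sum>b\<in>keys v. smult (lookup v b) (single b 1))"
    by (simp add: smult_single sum_singles)
  also have "\<dots> = lin (\<lambda>b. D (single b 1)) v"
    by (simp add: sum scale lin_def)
  finally show ?thesis .
qed

lemma hom_mem_subspace:
  assumes "module_hom smult smult D" "fm.subspace N"
    and "\<And>b. b \<in> B \<Longrightarrow> D (single b 1) \<in> N" "v \<in> free_on B"
  shows "D v \<in> N"
  using assms unfolding hom_eq_lin[OF assms(1), of v] lin_def free_on_def
  by (auto intro!: fm.subspace_sum fm.subspace_scale)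

section \<open>Degrees and homogeneous components in graded free modules\<close>

lemma vhomogeneous_iff:
  "vhomogeneous d j v \<longleftrightarrow> (\<forall>b t. lookup (lookup v b) t \<noteq> 0 \<longrightarrow> int (mdeg t) + d b = j)"
  unfolding vhomogeneous_def Ball_def in_keys_iff by (metis lookup_zero)

lemma mdeg_add: "mdeg (s + t) = mdeg s + mdeg t"
  by (simp add: mdeg_def lookup_add sum.distrib)

lemma mdeg_zero [simp]: "mdeg 0 = 0"
  by (simp add: mdeg_def)

lemma vhomogeneous_zero [simp]: "vhomogeneous d j 0"
  by (simp add: vhomogeneous_iff)

lemma vhomogeneous_add: "vhomogeneous d j v \<Longrightarrow> vhomogeneous d j w \<Longrightarrow> vhomogeneous d j (v + w)"
  unfolding vhomogeneous_iff lookup_add by (metis add.right_neutral)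

lemma vhomogeneous_diff: "vhomogeneous d j v \<Longrightarrow> vhomogeneous d j w \<Longrightarrow> vhomogeneous d j (v - w)"
  unfolding vhomogeneous_iff lookup_minus by (metis diff_zero)

lemma vhomogeneous_sum: "(\<And>x. x \<in> A \<Longrightarrow> vhomogeneous d j (f x)) \<Longrightarrow> vhomogeneous d j (sum f A)"
  by (induction A rule: infinite_finite_induct) (auto intro: vhomogeneous_add)

lemma vhomogeneous_smult:
  assumes "\<And>t. t \<in> keys p \<Longrightarrow> int (mdeg t) + k = j" "vhomogeneous d k v"
  shows "vhomogeneous d j (smult p v)"
  unfolding vhomogeneous_def
proof (intro ballI)
  fix b t assume "t \<in> keys (lookup (smult p v) b)"
  then obtain s u where "t = s + u" "s \<in> keys p" "u \<in> keys (lookup v b)"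
    using keys_mult[of p "lookup v b"] by auto
  moreover have "int (mdeg u) + d b = k"
    using assms(2) \<open>u \<in> _\<close> by (auto simp: vhomogeneous_iff in_keys_iff)
  ultimately show "int (mdeg t) + d b = j"
    using assms(1)[of s] by (simp add: mdeg_add)
qed

lemma vhomogeneous_single_one [simp]: "vhomogeneous d (d b) (single b 1)"
  by (auto simp: vhomogeneous_iff lookup_single lookup_one when_def split: if_splits)

lemma vhomogeneous_const_vec:
  "v \<in> free_on {b. d b = j} \<Longrightarrow> vhomogeneous d j (const_vec v)"
  by (auto simp: vhomogeneous_iff const_vec_def mem_free_on lookup_map_zero Const_def
      lookup_single when_def split: if_splits)

text \<open>\<open>mapp\<close> is used because whether a coefficient survives depends on its
  exponent and on the index of its basis element.\<close>

definition hcomp :: "(nat \<Rightarrow> int) \<Rightarrow> int \<Rightarrow> ('n::finite, 'k::field) fvec \<Rightarrow> ('n, 'k) fvec" where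
  "hcomp d j v = Poly_Mapping.mapp
     (\<lambda>b. Poly_Mapping.mapp (\<lambda>t c. c when int (mdeg t) + d b = j)) v"

lemma lookup_hcomp:
  "lookup (lookup (hcomp d j v) b) t = (lookup (lookup v b) t when int (mdeg t) + d b = j)"
  by (auto simp: hcomp_def lookup_mapp when_def in_keys_iff)

lemma fvec_eqI: "(\<And>b t. lookup (lookup v b) t = lookup (lookup w b) t) \<Longrightarrow> v = w"
  by (rule poly_mapping_eqI, rule poly_mapping_eqI) blast

lemma vhomogeneous_hcomp: "vhomogeneous d j (hcomp d j v)"
  by (simp add: vhomogeneous_iff lookup_hcomp)

lemma hcomp_add: "hcomp d j (v + w) = hcomp d j v + hcomp d j w"
  by (rule fvec_eqI) (simp add: lookup_hcomp lookup_add when_def)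

lemma hcomp_zero [simp]: "hcomp d j 0 = 0"
  by (rule fvec_eqI) (simp add: lookup_hcomp)

lemma hcomp_sum: "hcomp d j (sum f A) = (\<Sum>x\<in>A. hcomp d j (f x))"
  by (induction A rule: infinite_finite_induct) (auto simp: hcomp_add)

lemma hcomp_homogeneous: "vhomogeneous d k v \<Longrightarrow> hcomp d j v = (if j = k then v else 0)"
  by (rule fvec_eqI) (auto simp: vhomogeneous_iff lookup_hcomp when_def)

lemma hcomp_free_on: "v \<in> free_on B \<Longrightarrow> hcomp d j v \<in> free_on B"
  unfolding mem_free_on by (auto intro!: poly_mapping_eqI simp: lookup_hcomp)

text \<open>Only finitely many degrees occur. The last property handles a degree outside
  \<open>J\<close> in \<open>hcomp_graded_hom\<close>.\<close>

lemma sum_hcomp: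
  obtains J where "finite J" "(\<Sum>j\<in>J. hcomp d j v) = v" "\<And>j. j \<notin> J \<Longrightarrow> hcomp d j v = 0"
proof
  let ?J = "\<Union>b\<in>keys v. (\<lambda>t. int (mdeg t) + d b) ` keys (lookup v b)"
  have J: "int (mdeg t) + d b \<in> ?J" if "lookup (lookup v b) t \<noteq> 0" for b t
    using that by (intro UN_I[of b]) (auto simp: in_keys_iff)
  show "finite ?J" by auto
  then show "(\<Sum>j\<in>?J. hcomp d j v) = v"
    using J by (intro fvec_eqI) (auto simp: lookup_sum lookup_hcomp when_def sum.delta')
  show "hcomp d j v = 0" if "j \<notin> ?J" for j
  proof (rule fvec_eqI)
    show "lookup (lookup (hcomp d j v) b) t = lookup (lookup 0 b) t" for b t
      using J[of b t] that by (auto simp only: lookup_hcomp when_def lookup_zero split: if_split)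
  qed
qed

section \<open>Graded homomorphisms and graded submodules\<close>

definition graded_hom ::
  "nat set \<Rightarrow> (nat \<Rightarrow> int) \<Rightarrow> nat set \<Rightarrow> (nat \<Rightarrow> int) \<Rightarrow>
    (('n::finite, 'k::field) fvec \<Rightarrow> ('n, 'k) fvec) \<Rightarrow> bool" where
  "graded_hom B d B' d' D \<longleftrightarrow> module_hom smult smult D \<and> D ` free_on B \<subseteq> free_on B' \<and>
     (\<forall>j. \<forall>v\<in>free_on B. vhomogeneous d j v \<longrightarrow> vhomogeneous d' j (D v))"

lemma graded_homD:
  assumes "graded_hom B d B' d' D"
  shows "module_hom smult smult D" "v \<in> free_on B \<Longrightarrow> D v \<in> free_on B'"
    "v \<in> free_on B \<Longrightarrow> vhomogeneous d j v \<Longrightarrow> vhomogeneous d' j (D v)"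
  using assms unfolding graded_hom_def by auto

lemma graded_hom_lin:
  fixes g :: "nat \<Rightarrow> ('n::finite, 'k::field) fvec"
  assumes "\<And>b. b \<in> B \<Longrightarrow> g b \<in> free_on B'" "\<And>b. b \<in> B \<Longrightarrow> vhomogeneous d' (d b) (g b)"
  shows "graded_hom B d B' d' (lin g)"
  unfolding graded_hom_def
proof (intro conjI module_hom_lin allI ballI impI)
  show "lin g ` free_on B \<subseteq> free_on B'"
    using assms(1) hom_mem_subspace[OF module_hom_lin subspace_free_on, of B g] by fastforce
  fix j and v :: "('n, 'k) fvec" assume v: "v \<in> free_on B" "vhomogeneous d j v"
  show "vhomogeneous d' j (lin g v)"
    unfolding lin_def
  proof (intro vhomogeneous_sum vhomogeneous_smult)
    fix b assume "b \<in> keys v"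
    then show "vhomogeneous d' (d b) (g b)" using v(1) assms(2) by (auto simp: free_on_def)
    show "int (mdeg t) + d b = j" if "t \<in> keys (lookup v b)" for t
      using that v(2) \<open>b \<in> keys v\<close> by (auto simp: vhomogeneous_def)
  qed
qed

lemma graded_hom_compose:
  "graded_hom B d B' d' f \<Longrightarrow> graded_hom B' d' B'' d'' g \<Longrightarrow> graded_hom B d B'' d'' (\<lambda>v. g (f v))"
  unfolding graded_hom_def using module_hom_compose[of smult smult f smult g]
  by (auto simp: o_def image_subset_iff)

lemma graded_hom_diff:
  assumes "graded_hom B d B' d' f" "graded_hom B d B' d' g"
  shows "graded_hom B d B' d' (\<lambda>v. f v - g v)"
proof -
  interpret module_pair "smult :: ('a, 'b) mpoly \<Rightarrow> _" "smult :: ('a, 'b) mpoly \<Rightarrow> _" ..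
  show ?thesis using assms unfolding graded_hom_def
    by (auto intro!: module_hom_sub vhomogeneous_diff fm.subspace_diff subspace_free_on)
qed

lemma graded_hom_id: "graded_hom B d B d (\<lambda>v. v)"
  unfolding graded_hom_def using fm.module_hom_ident by auto

text \<open>Split \<open>v\<close> into components: \<open>D\<close> preserves the degree of each,
  so only the image of the \<open>j\<close>-th one contributes in degree \<open>j\<close>.\<close>

lemma hcomp_graded_hom:
  assumes D: "graded_hom B d B' d' D" and v: "v \<in> free_on B"
  shows "hcomp d' j (D v) = D (hcomp d j v)"
proof -
  interpret module_hom smult smult D using graded_homD(1)[OF D] .
  obtain J where J: "finite J" "(\<Sum>j\<in>J. hcomp d j v) = v" "\<And>j. j \<notin> J \<Longrightarrow> hcomp d j v = 0"
    using sum_hcomp[of d v] by blast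
  have "hcomp d' j (D v) = (\<Sum>k\<in>J. hcomp d' j (D (hcomp d k v)))"
    by (subst J(2)[symmetric]) (simp add: sum hcomp_sum)
  also have "\<dots> = (\<Sum>k\<in>J. if j = k then D (hcomp d k v) else 0)"
    using graded_homD(3)[OF D hcomp_free_on[OF v] vhomogeneous_hcomp]
    by (intro sum.cong refl hcomp_homogeneous) 
  also have "\<dots> = D (hcomp d j v)"
    using J by (auto simp: sum.delta)
  finally show ?thesis .
qed

definition graded_sub ::
  "nat set \<Rightarrow> (nat \<Rightarrow> int) \<Rightarrow> ('n::finite, 'k::field) fvec set \<Rightarrow> bool" where
  "graded_sub B d N \<longleftrightarrow> fm.subspace N \<and> N \<subseteq> free_on B \<and> (\<forall>v\<in>N. \<forall>j. hcomp d j v \<in> N)"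

lemma graded_sub_zero: "graded_sub B d {0}"
  by (auto simp: graded_sub_def mem_free_on)

lemma graded_sub_preimage:
  assumes D: "graded_hom B d B' d' D" and N: "graded_sub B' d' N"
  shows "graded_sub B d {v \<in> free_on B. D v \<in> N}"
proof -
  interpret module_hom smult smult D using graded_homD(1)[OF D] .
  show ?thesis using N
    unfolding graded_sub_def
    by (auto intro!: fm.subspaceI simp: add scale fm.subspace_add fm.subspace_scale fm.subspace_0
       subspace_free_on hcomp_free_on hcomp_graded_hom[OF D, symmetric])
qed

lemma graded_sub_kernel:
  assumes "graded_hom B d B' d' D"
  shows "graded_sub B d {v \<in> free_on B. D v = 0}"
  using graded_sub_preimage[OF assms graded_sub_zero] by simp

text \<open>Projectivity of free modules in graded form. Basis elements are lifted one at a time; a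
  lift can be replaced by its component of the right degree because \<open>N\<close> contains the
  components of its elements. Working modulo \<open>N\<close> lets one lemma serve the augmentation
  (\<open>N\<close> from \<open>I\<close>) and the higher maps (\<open>N = {0}\<close>).\<close>

lemma graded_lift:
  assumes phi: "graded_hom A e B d \<phi>" and D: "graded_hom C c B d D" and N: "graded_sub B d N"
    and ex: "\<And>v. v \<in> free_on A \<Longrightarrow> \<exists>w\<in>free_on C. \<phi> v - D w \<in> N"
  shows "\<exists>\<psi>. graded_hom A e C c \<psi> \<and> (\<forall>v\<in>free_on A. \<phi> v - D (\<psi> v) \<in> N)"
proof -
  have "\<exists>w. w \<in> free_on C \<and> vhomogeneous c (e a) w \<and> \<phi> (single a 1) - D w \<in> N" if a: "a \<in> A" for a
  proof -
    from ex[OF single_mem_free_on[OF a, of 1]] obtain w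
      where w: "w \<in> free_on C" "\<phi> (single a 1) - D w \<in> N" by blast
    \<comment> \<open>The image of a basis element is already homogeneous, so passing to the
      component of degree \<open>e a\<close> changes only \<open>w\<close>.\<close>
    have "hcomp d (e a) (\<phi> (single a 1)) = \<phi> (single a 1)"
      using graded_homD(3)[OF phi single_mem_free_on[OF a] vhomogeneous_single_one]
      by (simp add: hcomp_homogeneous)
    moreover have "hcomp d (e a) (\<phi> (single a 1) - D w) = hcomp d (e a) (\<phi> (single a 1)) - hcomp d (e a) (D w)"
      by (metis add_diff_cancel diff_add_cancel hcomp_add)
    ultimately have "\<phi> (single a 1) - D (hcomp c (e a) w) \<in> N"
      using N w unfolding graded_sub_def by (metis hcomp_graded_hom[OF D])
    then show ?thesis using w(1) hcomp_free_on vhomogeneous_hcomp by blast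
  qed
  then obtain g where g: "\<And>a. a \<in> A \<Longrightarrow> g a \<in> free_on C \<and> vhomogeneous c (e a) (g a) \<and>
      \<phi> (single a 1) - D (g a) \<in> N"
    by metis
  have gh: "graded_hom A e C c (lin g)" using g by (intro graded_hom_lin) auto
  have "graded_hom A e B d (\<lambda>v. \<phi> v - D (lin g v))"
    by (intro graded_hom_diff phi graded_hom_compose[OF gh D])
  then have "\<phi> v - D (lin g v) \<in> N" if "v \<in> free_on A" for v
    using hom_mem_subspace[of "\<lambda>v. \<phi> v - D (lin g v)" N A v] that g N
    by (auto simp: graded_hom_def graded_sub_def)
  with gh show ?thesis by blast
qed

section \<open>Existence of graded free resolutions\<close>

lemma lookup_Const_mult [simp]: "lookup (Const c * p) t = c * lookup p t"
  unfolding Const_def mult_map_scale_conv_mult[symmetric] by (simp add: lookup_map_zero)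

lemma keys_Const: "keys (Const c) \<subseteq> {0}"
  by (simp add: Const_def)

text \<open>
  The generators are elements with prescribed leading term for an arbitrary enumeration of the
  countably many terms, so countably many suffice even over an uncountable field.
\<close>

lemma graded_sub_cover:
  fixes M :: "('n::finite, 'k::field) fvec set"
  assumes M: "graded_sub B d M"
  shows "\<exists>B' d' D. graded_hom B' d' B d D \<and> D ` free_on B' = M"
proof -
  \<comment> \<open>A numbering of all terms; the exponent vector enters as a function on the finite
    type \<open>'n\<close>, so the pair lies in a countable type.\<close>
  define e :: "nat \<Rightarrow> ('n \<Rightarrow>\<^sub>0 nat) \<Rightarrow> nat" where "e b t = to_nat (b, lookup t)" for b t
  have e_inj: "e b t = e b' t' \<longleftrightarrow> b = b' \<and> t = t'" for b b' t t'
    by (simp add: e_def lookup_inject)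
  define bnd where "bnd N v \<longleftrightarrow> (\<forall>b t. lookup (lookup v b) t \<noteq> 0 \<longrightarrow> e b t < N)"
    for N and v :: "('n, 'k) fvec"
  \<comment> \<open>Homogeneous elements of \<open>M\<close> whose highest term has number
    \<open>N\<close>. One of them for each possible \<open>N\<close> will generate
    \<open>M\<close>.\<close>
  define lead where "lead N j v \<longleftrightarrow> v \<in> M \<and> vhomogeneous d j v \<and> bnd (Suc N) v \<and>
      (\<exists>b t. e b t = N \<and> lookup (lookup v b) t \<noteq> 0)" for N j v
  define B' where "B' = {N. \<exists>j v. lead N j v}"
  have "\<forall>N\<in>B'. \<exists>x. lead N (fst x) (snd x)" unfolding B'_def by simp
  from bchoice[OF this] obtain x where x: "\<forall>N\<in>B'. lead N (fst (x N)) (snd (x N))" ..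
  define d' g where "d' N = fst (x N)" and "g N = snd (x N)" for N
  have g: "lead N (d' N) (g N)" if "N \<in> B'" for N
    using x that by (simp add: d'_def g_def)
  have sub: "fm.subspace M" and MB: "M \<subseteq> free_on B" and Mh: "\<And>v j. v \<in> M \<Longrightarrow> hcomp d j v \<in> M"
    using M by (auto simp: graded_sub_def)
  have gh: "graded_hom B' d' B d (lin g)"
    using g MB by (intro graded_hom_lin) (auto simp: lead_def)
  interpret L: module_hom smult smult "lin g" by (rule module_hom_lin)
  have sub_im: "fm.subspace (lin g ` free_on B')"
    by (rule L.subspace_image[OF subspace_free_on])
  \<comment> \<open>Elimination by induction on the bound: a scalar multiple of \<open>g N\<close>
    cancels the highest term. Since only constants are multiplied, the numbering need not be
    compatible with products of monomials.\<close>
  have key: "v \<in> lin g ` free_on B'" if "bnd N v" "v \<in> M" "vhomogeneous d j v" for N v j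
    using that
  proof (induction N arbitrary: v)
    case 0
    have "v = 0" by (rule fvec_eqI) (use 0 in \<open>auto simp: bnd_def\<close>)
    then show ?case using fm.subspace_0[OF sub_im] by simp
  next
    case (Suc N)
    show ?case
    proof (cases "\<exists>b t. e b t = N \<and> lookup (lookup v b) t \<noteq> 0")
      case False
      then have "bnd N v" using Suc.prems(1) unfolding bnd_def by (metis less_SucE)
      then show ?thesis using Suc.IH Suc.prems by blast
    next
      case True
      then obtain b t where bt: "e b t = N" "lookup (lookup v b) t \<noteq> 0" by blast
      have N: "N \<in> B'" using Suc.prems True unfolding B'_def lead_def by blast
      note gN = g[OF N, unfolded lead_def]
      have a: "lookup (lookup (g N) b) t \<noteq> 0" using gN bt(1) e_inj by metis
      \<comment> \<open>The term numbered \<open>N\<close> occurs in both \<open>g N\<close> and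
        \<open>v\<close> and determines their degrees, so \<open>w\<close> below is again
        homogeneous.\<close>
      have j: "d' N = j" using gN Suc.prems(3) bt(2) a unfolding vhomogeneous_iff by metis
      define c where "c = lookup (lookup v b) t / lookup (lookup (g N) b) t"
      define w where "w = v - smult (Const c) (g N)"
      have lw: "lookup (lookup w b') t' = lookup (lookup v b') t' - c * lookup (lookup (g N) b') t'" for b' t'
        by (simp add: w_def lookup_minus)
      have "w \<in> M" unfolding w_def using gN Suc.prems sub
        by (intro fm.subspace_diff fm.subspace_scale) auto
      moreover have "vhomogeneous d j w" unfolding w_def
        using gN Suc.prems j keys_Const[of c] by (intro vhomogeneous_diff vhomogeneous_smult) auto
      moreover have "bnd N w" unfolding bnd_def
      proof (intro allI impI)
        fix b' t' assume nz: "lookup (lookup w b') t' \<noteq> 0"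
        then have "lookup (lookup v b') t' \<noteq> 0 \<or> lookup (lookup (g N) b') t' \<noteq> 0"
          by (auto simp: lw)
        then have "e b' t' < Suc N" using gN Suc.prems(1) unfolding bnd_def by blast
        moreover have "e b' t' \<noteq> N"
        proof
          assume "e b' t' = N"
          then have "b' = b" "t' = t" using bt e_inj by auto
          then show False using nz a by (simp add: lw c_def)
        qed
        ultimately show "e b' t' < N" by simp
      qed
      ultimately have "w \<in> lin g ` free_on B'" by (intro Suc.IH)
      moreover have "smult (Const c) (g N) \<in> lin g ` free_on B'"
        by (rule image_eqI[of _ _ "single N (Const c)"]) (simp_all add: single_mem_free_on N)
      ultimately have "w + smult (Const c) (g N) \<in> lin g ` free_on B'"
        by (rule fm.subspace_add[OF sub_im])
      then show ?thesis by (simp add: w_def)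
    qed
  qed
  have "\<exists>N. bnd N v" for v
  proof -
    have "finite (\<Union>b\<in>keys v. e b ` keys (lookup v b))" by auto
    then obtain N where "\<forall>n\<in>(\<Union>b\<in>keys v. e b ` keys (lookup v b)). n < N"
      using finite_nat_set_iff_bounded by blast
    then have "e b t < N" if "lookup (lookup v b) t \<noteq> 0" for b t
      using that by (force simp: in_keys_iff)
    then show ?thesis unfolding bnd_def by blast
  qed
  then have hom: "v \<in> lin g ` free_on B'" if "v \<in> M" "vhomogeneous d j v" for v j
    using key that by blast
  have "M \<subseteq> lin g ` free_on B'"
  proof
    fix v assume v: "v \<in> M"
    obtain J where "(\<Sum>j\<in>J. hcomp d j v) = v" using sum_hcomp[of d v] by blast
    moreover have "(\<Sum>j\<in>J. hcomp d j v) \<in> lin g ` free_on B'"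
      by (intro fm.subspace_sum sub_im hom[OF Mh[OF v] vhomogeneous_hcomp])
    ultimately show "v \<in> lin g ` free_on B'" by simp
  qed
  moreover have "lin g ` free_on B' \<subseteq> M"
    using hom_mem_subspace[OF module_hom_lin sub, of B' g] g by (auto simp: lead_def)
  ultimately show ?thesis using gh by blast
qed

lemma free_on_singleton: "v \<in> free_on {b} \<Longrightarrow> v = single b (lookup v b)"
  by (rule poly_mapping_eqI) (auto simp: mem_free_on lookup_single when_def)

lemma module_hom_single: "module_hom (*) smult (single b)"
  by unfold_locales (simp_all add: single_add smult_single)

lemma module_hom_lookup: "module_hom smult (*) (\<lambda>v. lookup v b)"
  by unfold_locales (simp_all add: lookup_add algebra_simps)

lemma homogeneous_ideal_subspace: "homogeneous_ideal I \<Longrightarrow> rg.subspace I"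
  by (auto simp: homogeneous_ideal_def ideal_gen_def)

text \<open>\<open>R\<close> is treated as the free module on one generator of degree 0, so that
  ideals fall under the lifting and covering lemmas. For a homogeneous generator \<open>x\<close>,
  each component of \<open>c * x\<close> is a component of \<open>c\<close> times
  \<open>x\<close>.\<close>

lemma homogeneous_ideal_graded_sub:
  assumes "homogeneous_ideal I"
  shows "graded_sub {0} (\<lambda>_. 0) (single 0 ` I)"
proof -
  obtain S where S: "\<And>f. f \<in> S \<Longrightarrow> \<exists>d. homogeneous d f" and I: "I = rg.span S"
    using assms unfolding homogeneous_ideal_def ideal_gen_def by blast
  have sub: "fm.subspace (single 0 ` I)"
    using module_hom.subspace_image[OF module_hom_single rg.subspace_span] by (simp add: I)
  have "hcomp (\<lambda>_. 0) j (single 0 p) \<in> single 0 ` I" if "p \<in> rg.span S" for p j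
    using that
  proof (induction rule: rg.span_induct_alt)
    case base
    show ?case using fm.subspace_0[OF sub] by simp
  next
    case (step c x y)
    obtain e where e: "homogeneous e x" using S step(1) by blast
    \<comment> \<open>Multiplication by \<open>x\<close> is graded once the generator of the source
      has degree \<open>e\<close>; hence it commutes with taking components.\<close>
    have gh: "graded_hom {0} (\<lambda>_. int e) {0} (\<lambda>_. 0) (lin (\<lambda>_. single 0 x))"
      using e by (intro graded_hom_lin)
        (auto simp: single_mem_free_on vhomogeneous_def homogeneous_def split: if_splits)
    have "hcomp (\<lambda>_. 0) j (single 0 (c * x)) = hcomp (\<lambda>_. 0) j (lin (\<lambda>_. single 0 x) (single 0 c))"
      by (simp add: smult_single)
    also have "\<dots> = lin (\<lambda>_. single 0 x) (hcomp (\<lambda>_. int e) j (single 0 c))"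
      by (rule hcomp_graded_hom[OF gh]) (simp add: single_mem_free_on)
    also have "hcomp (\<lambda>_. int e) j (single 0 c) = single 0 (lookup (hcomp (\<lambda>_. int e) j (single 0 c)) 0)"
      by (intro free_on_singleton hcomp_free_on single_mem_free_on) simp
    finally have "hcomp (\<lambda>_. 0) j (single 0 (c * x)) \<in> single 0 ` I"
      using step(1) by (auto simp: smult_single I intro: rg.span_scale rg.span_base)
    then show ?case using step(2) fm.subspace_add[OF sub]
      by (simp add: single_add hcomp_add)
  qed
  then show ?thesis using sub by (auto simp: graded_sub_def I single_mem_free_on)
qed

theorem graded_free_resolution_exists:
  fixes I :: "('n::finite, 'k::field) mpoly set"
  assumes hI: "homogeneous_ideal I"
  shows "\<exists>F. graded_free_resolution I F"
proof -
  \<comment> \<open>A stage is a triple: basis and degrees of \<open>F_n\<close>, and the submodule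
    of \<open>F_n\<close> that the next map must hit. It is \<open>I\<close> inside \<open>R\<close>
    at the start, and by \<open>Q\<close> the kernel of the preceding map afterwards.\<close>
  define P where "P n x \<longleftrightarrow> graded_sub (fst x) (fst (snd x)) (snd (snd x)) \<and>
      (n = 0 \<longrightarrow> x = ({0}, \<lambda>_. 0, single 0 ` I))"
    for n :: nat and x :: "nat set \<times> (nat \<Rightarrow> int) \<times> ('n, 'k) fvec set"
  define Q where "Q x y \<longleftrightarrow> (\<exists>D. graded_hom (fst y) (fst (snd y)) (fst x) (fst (snd x)) D \<and>
      D ` free_on (fst y) = snd (snd x) \<and> snd (snd y) = {v \<in> free_on (fst y). D v = 0})"
    for x y :: "nat set \<times> (nat \<Rightarrow> int) \<times> ('n, 'k) fvec set"
  have "\<exists>f. \<forall>n. P n (f n) \<and> Q (f n) (f (Suc n))"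
  proof (rule dependent_nat_choice)
    show "\<exists>x. P 0 x" using homogeneous_ideal_graded_sub[OF hI] by (auto simp: P_def)
    fix x n assume "P n x"
    then obtain B' d' D where D: "graded_hom B' d' (fst x) (fst (snd x)) D" "D ` free_on B' = snd (snd x)"
      using graded_sub_cover unfolding P_def by metis
    then show "\<exists>y. P (Suc n) y \<and> Q x y"
      using graded_sub_kernel[OF D(1)]
      by (intro exI[of _ "(B', d', {v \<in> free_on B'. D v = 0})"]) (auto simp: P_def Q_def)
  qed
  then obtain f where f: "\<And>n. P n (f n)" "\<And>n. Q (f n) (f (Suc n))" by blast
  define B d M where "B n = fst (f n)" and "d n = fst (snd (f n))" and "M n = snd (snd (f n))" for n
  have f0: "B 0 = {0}" "d 0 = (\<lambda>_. 0)" "M 0 = single 0 ` I"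
    using f(1)[of 0] by (simp_all add: P_def B_def d_def M_def)
  have "\<forall>n. \<exists>D. graded_hom (B (Suc n)) (d (Suc n)) (B n) (d n) D \<and>
      D ` free_on (B (Suc n)) = M n \<and> M (Suc n) = {v \<in> free_on (B (Suc n)). D v = 0}"
    using f(2) unfolding Q_def B_def d_def M_def by blast
  from choice[OF this] obtain D where
    D0: "\<forall>n. graded_hom (B (Suc n)) (d (Suc n)) (B n) (d n) (D n) \<and>
      D n ` free_on (B (Suc n)) = M n \<and> M (Suc n) = {v \<in> free_on (B (Suc n)). D n v = 0}" ..
  have D: "graded_hom (B (Suc n)) (d (Suc n)) (B n) (d n) (D n)"
    "D n ` free_on (B (Suc n)) = M n" "M (Suc n) = {v \<in> free_on (B (Suc n)). D n v = 0}" for n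
    using spec[OF D0, of n] by simp_all
  have M0: "M 0 = {v \<in> free_on {0}. lookup v 0 \<in> I}"
    unfolding f0 using free_on_singleton by (fastforce simp: single_mem_free_on)
  have "graded_free_resolution I \<lparr>basis = B, bdeg = d, bdry = D, aug = \<lambda>v. lookup v 0\<rparr>"
    unfolding graded_free_resolution_def free_complex.simps
  proof (intro conjI allI ballI impI)
    show "module_hom smult smult (D i)" for i using D(1) graded_homD(1) by blast
    show "vhomogeneous (d i) j (D i v)"
      if "v \<in> free_on (B (Suc i))" "vhomogeneous (d (Suc i)) j v" for i j v
      using graded_homD(3)[OF D(1)] that by blast
    show "int (mdeg t) = j"
      if "v \<in> free_on (B 0)" "vhomogeneous (d 0) j v" "t \<in> keys (lookup v 0)" for j v t
      using that(2,3) by (auto simp: vhomogeneous_iff f0 in_keys_iff)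
    show "\<exists>v\<in>free_on (B 0). r - lookup v 0 \<in> I" for r
      using rg.subspace_0[OF homogeneous_ideal_subspace[OF hI]]
      by (intro bexI[of _ "single 0 r"]) (auto simp: f0 single_mem_free_on)
    show "D 0 ` free_on (B (Suc 0)) = {v \<in> free_on (B 0). lookup v 0 \<in> I}"
      using D(2)[of 0] M0 f0 by simp
    show "D (Suc i) ` free_on (B (Suc (Suc i))) = {v \<in> free_on (B (Suc i)). D i v = 0}" for i
      using D(2)[of "Suc i"] D(3)[of i] by simp
  qed (rule module_hom_lookup)
  then show ?thesis by blast
qed

section \<open>Comparison of resolutions\<close>

text \<open>The submodule that must equal the image of \<open>bdry F i\<close>. One name for both
  exactness conditions avoids separate treatment of the augmentation.\<close>

fun syz :: "('n::finite, 'k::field) mpoly set \<Rightarrow> ('n, 'k) free_complex \<Rightarrow> nat \<Rightarrow> ('n, 'k) fvec set" where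
  "syz I F 0 = {v \<in> free_on (basis F 0). aug F v \<in> I}"
| "syz I F (Suc i) = {v \<in> free_on (basis F (Suc i)). bdry F i v = 0}"

lemma resolution_bdry:
  assumes "graded_free_resolution I F"
  shows "graded_hom (basis F (Suc i)) (bdeg F (Suc i)) (basis F i) (bdeg F i) (bdry F i)"
    and "bdry F i ` free_on (basis F (Suc i)) = syz I F i"
proof -
  show 1: "bdry F i ` free_on (basis F (Suc i)) = syz I F i"
    using assms unfolding graded_free_resolution_def by (cases i) auto
  have "syz I F i \<subseteq> free_on (basis F i)" by (cases i) auto
  moreover have "\<forall>i. module_hom smult smult (bdry F i)"
    using assms unfolding graded_free_resolution_def by - (elim conjE, assumption)
  moreover have "\<forall>i j. \<forall>v\<in>free_on (basis F (Suc i)).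
        vhomogeneous (bdeg F (Suc i)) j v \<longrightarrow> vhomogeneous (bdeg F i) j (bdry F i v)"
    using assms unfolding graded_free_resolution_def by - (elim conjE, assumption)
  ultimately show "graded_hom (basis F (Suc i)) (bdeg F (Suc i)) (basis F i) (bdeg F i) (bdry F i)"
    by (simp add: graded_hom_def 1)
qed

lemma bdry_mem_syz:
  "graded_free_resolution I F \<Longrightarrow> v \<in> free_on (basis F (Suc i)) \<Longrightarrow> bdry F i v \<in> syz I F i"
  using resolution_bdry(2) by blast

lemma bdry_bdry:
  "graded_free_resolution I F \<Longrightarrow> v \<in> free_on (basis F (Suc (Suc i))) \<Longrightarrow> bdry F i (bdry F (Suc i) v) = 0"
  using bdry_mem_syz[of I F v "Suc i"] by simp

lemma resolution_aug_hom: "graded_free_resolution I F \<Longrightarrow> module_hom smult (*) (aug F)"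
  unfolding graded_free_resolution_def by (elim conjE, assumption)

lemma resolution_aug_surj:
  "graded_free_resolution I F \<Longrightarrow> \<exists>v\<in>free_on (basis F 0). r - aug F v \<in> I"
  unfolding graded_free_resolution_def by (elim conjE, erule spec)

text \<open>Turns the augmentation into a map between graded free modules, to which
  \<open>graded_lift\<close> applies.\<close>

lemma resolution_aug:
  assumes "graded_free_resolution I F"
  shows "graded_hom (basis F 0) (bdeg F 0) {0} (\<lambda>_. 0) (\<lambda>v. single 0 (aug F v))"
proof -
  have "module_hom smult smult (\<lambda>v. single 0 (aug F v))"
    using module_hom_compose[OF resolution_aug_hom[OF assms] module_hom_single] by (simp add: o_def)
  moreover have "vhomogeneous (\<lambda>_. 0) j (single 0 (aug F v))"
    if "v \<in> free_on (basis F 0)" "vhomogeneous (bdeg F 0) j v" for j v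
    using assms that unfolding graded_free_resolution_def
    by (auto simp: vhomogeneous_def split: if_splits)
  ultimately show ?thesis
    by (auto simp: graded_hom_def single_mem_free_on)
qed

text \<open>Compatibility with the augmentations is left out, so that differences such as the
  identity minus a composite also qualify.\<close>

definition chain_map ::
  "('n::finite, 'k::field) free_complex \<Rightarrow> ('n, 'k) free_complex \<Rightarrow>
    (nat \<Rightarrow> ('n, 'k) fvec \<Rightarrow> ('n, 'k) fvec) \<Rightarrow> bool" where
  "chain_map F G f \<longleftrightarrow>
     (\<forall>i. graded_hom (basis F i) (bdeg F i) (basis G i) (bdeg G i) (f i)) \<and>
     (\<forall>i. \<forall>v\<in>free_on (basis F (Suc i)). bdry G i (f (Suc i) v) = f i (bdry F i v))"

lemma chain_mapD:
  assumes "chain_map F G f"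
  shows "graded_hom (basis F i) (bdeg F i) (basis G i) (bdeg G i) (f i)"
    "v \<in> free_on (basis F (Suc i)) \<Longrightarrow> bdry G i (f (Suc i) v) = f i (bdry F i v)"
  using assms unfolding chain_map_def by auto

lemma chain_map_compose:
  "chain_map F G f \<Longrightarrow> chain_map G H g \<Longrightarrow> chain_map F H (\<lambda>i v. g i (f i v))"
proof -
  assume f: "chain_map F G f" and g: "chain_map G H g"
  have "bdry H i (g (Suc i) (f (Suc i) v)) = g i (f i (bdry F i v))"
    if "v \<in> free_on (basis F (Suc i))" for i v
    using chain_mapD(2)[OF g graded_homD(2)[OF chain_mapD(1)[OF f] that]] chain_mapD(2)[OF f that]
    by simp
  then show "chain_map F H (\<lambda>i v. g i (f i v))"
    using graded_hom_compose[OF chain_mapD(1)[OF f] chain_mapD(1)[OF g]] by (simp add: chain_map_def)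
qed

text \<open>Degree 0 is lifted modulo \<open>I\<close>, the others exactly. The invariant that
  syzygies go to syzygies is what allows the next lift: \<open>f (bdry F n v)\<close> is then a
  syzygy of \<open>G\<close>, hence a boundary.\<close>

lemma comparison_map:
  fixes I :: "('n::finite, 'k::field) mpoly set"
  assumes hI: "homogeneous_ideal I"
    and F: "graded_free_resolution I F" and G: "graded_free_resolution I G"
  shows "\<exists>f. chain_map F G f \<and> (\<forall>v\<in>free_on (basis F 0). aug F v - aug G (f 0 v) \<in> I)"
proof -
  note sI = homogeneous_ideal_subspace[OF hI]
  define P where "P n f \<longleftrightarrow> graded_hom (basis F n) (bdeg F n) (basis G n) (bdeg G n) f \<and>
      f ` syz I F n \<subseteq> syz I G n \<and>
      (n = 0 \<longrightarrow> (\<forall>v\<in>free_on (basis F 0). aug F v - aug G (f v) \<in> I))" for n f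
  define Q where "Q n f f' \<longleftrightarrow> (\<forall>v\<in>free_on (basis F (Suc n)). bdry G n (f' v) = f (bdry F n v))"
    for n f f'
  have "\<exists>f. \<forall>n. P n (f n) \<and> Q n (f n) (f (Suc n))"
  proof (rule dependent_nat_choice)
    have "\<exists>w\<in>free_on (basis G 0). single 0 (aug F v) - single 0 (aug G w) \<in> single 0 ` I" for v
    proof -
      obtain w where "w \<in> free_on (basis G 0)" "aug F v - aug G w \<in> I"
        using resolution_aug_surj[OF G] by blast
      then show ?thesis unfolding single_diff[symmetric] by blast
    qed
    with graded_lift[OF resolution_aug[OF F] resolution_aug[OF G] homogeneous_ideal_graded_sub[OF hI]]
    obtain f where f: "graded_hom (basis F 0) (bdeg F 0) (basis G 0) (bdeg G 0) f"
      "\<And>v. v \<in> free_on (basis F 0) \<Longrightarrow> single 0 (aug F v) - single 0 (aug G (f v)) \<in> single (0::nat) ` I"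
      by blast
    have f': "aug F v - aug G (f v) \<in> I" if "v \<in> free_on (basis F 0)" for v
      using f(2)[OF that] unfolding single_diff[symmetric] by (simp add: inj_image_mem_iff)
    have "aug G (f v) \<in> I" if "v \<in> free_on (basis F 0)" "aug F v \<in> I" for v
      using rg.subspace_diff[OF sI that(2) f'[OF that(1)]] by simp
    then show "\<exists>f. P 0 f" using f(1) f' graded_homD(2)[OF f(1)] unfolding P_def
      by (intro exI[of _ f]) auto
  next
    fix f n assume f: "P n f"
    then have fh: "graded_hom (basis F n) (bdeg F n) (basis G n) (bdeg G n) f"
      and fs: "f ` syz I F n \<subseteq> syz I G n" by (auto simp: P_def)
    have "\<exists>w\<in>free_on (basis G (Suc n)). f (bdry F n v) - bdry G n w \<in> {0}"
      if "v \<in> free_on (basis F (Suc n))" for v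
    proof -
      have "f (bdry F n v) \<in> syz I G n" using fs bdry_mem_syz[OF F that] by blast
      then obtain w where "w \<in> free_on (basis G (Suc n))" "f (bdry F n v) = bdry G n w"
        using resolution_bdry(2)[OF G, of n] by blast
      then show ?thesis by auto
    qed
    with graded_lift[OF graded_hom_compose[OF resolution_bdry(1)[OF F] fh]
        resolution_bdry(1)[OF G] graded_sub_zero]
    obtain f' where f': "graded_hom (basis F (Suc n)) (bdeg F (Suc n)) (basis G (Suc n)) (bdeg G (Suc n)) f'"
      "\<And>v. v \<in> free_on (basis F (Suc n)) \<Longrightarrow> f (bdry F n v) - bdry G n (f' v) \<in> {0}"
      by blast
    have "f 0 = 0" using module_hom.zero[OF graded_homD(1)[OF fh]] .
    then have "P (Suc n) f'" "Q n f f'" unfolding P_def Q_def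
      using f' graded_homD(2)[OF f'(1)] by fastforce+
    then show "\<exists>f'. P (Suc n) f' \<and> Q n f f'" by blast
  qed
  then obtain f where f: "\<And>n. P n (f n)" "\<And>n. Q n (f n) (f (Suc n))" by blast
  then show ?thesis by (intro exI[of _ f]) (auto simp: chain_map_def P_def Q_def)
qed

text \<open>By hypothesis \<open>u 0\<close> lands in the image of \<open>bdry F 0\<close>, which
  gives \<open>h 0\<close>; afterwards \<open>u (Suc n)\<close> minus \<open>h n\<close> after
  \<open>bdry F n\<close> takes values in cycles, and exactness provides the next lift.\<close>

lemma null_homotopy:
  fixes F :: "('n::finite, 'k::field) free_complex"
  assumes F: "graded_free_resolution I F" and u: "chain_map F F u"
    and u0: "\<And>v. v \<in> free_on (basis F 0) \<Longrightarrow> u 0 v \<in> syz I F 0"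
  obtains h where "\<And>i. graded_hom (basis F i) (bdeg F i) (basis F (Suc i)) (bdeg F (Suc i)) (h i)"
    "\<And>v. v \<in> free_on (basis F 0) \<Longrightarrow> u 0 v = bdry F 0 (h 0 v)"
    "\<And>i v. v \<in> free_on (basis F (Suc i)) \<Longrightarrow>
      u (Suc i) v = bdry F (Suc i) (h (Suc i) v) + h i (bdry F i v)"
proof -
  \<comment> \<open>The second clause carries the induction: it says that the map to be lifted next
    is killed by \<open>bdry F n\<close>.\<close>
  define P where "P n h \<longleftrightarrow> graded_hom (basis F n) (bdeg F n) (basis F (Suc n)) (bdeg F (Suc n)) h \<and>
      (\<forall>v\<in>free_on (basis F (Suc n)). bdry F n (h (bdry F n v)) = u n (bdry F n v)) \<and>
      (n = 0 \<longrightarrow> (\<forall>v\<in>free_on (basis F 0). u 0 v = bdry F 0 (h v)))" for n h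
  define Q where "Q n h h' \<longleftrightarrow> (\<forall>v\<in>free_on (basis F (Suc n)).
      u (Suc n) v = bdry F (Suc n) (h' v) + h (bdry F n v))" for n h h'
  note uh = chain_mapD(1)[OF u] and uc = chain_mapD(2)[OF u]
  note dh = resolution_bdry(1)[OF F]
  have "\<exists>h. \<forall>n. P n (h n) \<and> Q n (h n) (h (Suc n))"
  proof (rule dependent_nat_choice)
    have "\<exists>w\<in>free_on (basis F (Suc 0)). u 0 v - bdry F 0 w \<in> {0}" if "v \<in> free_on (basis F 0)" for v
      using u0[OF that] resolution_bdry(2)[OF F, of 0] by force
    with graded_lift[OF uh dh graded_sub_zero]
    obtain h where h: "graded_hom (basis F 0) (bdeg F 0) (basis F (Suc 0)) (bdeg F (Suc 0)) h"
      "\<And>v. v \<in> free_on (basis F 0) \<Longrightarrow> u 0 v - bdry F 0 (h v) \<in> {0}"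
      by blast
    then have "P 0 h" unfolding P_def using graded_homD(2)[OF dh] by auto
    then show "\<exists>h. P 0 h" by blast
  next
    fix h n assume "P n h"
    then have hh: "graded_hom (basis F n) (bdeg F n) (basis F (Suc n)) (bdeg F (Suc n)) h"
      and hc: "\<And>v. v \<in> free_on (basis F (Suc n)) \<Longrightarrow> bdry F n (h (bdry F n v)) = u n (bdry F n v)"
      by (auto simp: P_def)
    let ?phi = "\<lambda>v. u (Suc n) v - h (bdry F n v)"
    have phi: "graded_hom (basis F (Suc n)) (bdeg F (Suc n)) (basis F (Suc n)) (bdeg F (Suc n)) ?phi"
      by (intro graded_hom_diff uh graded_hom_compose[OF dh hh])
    have "\<exists>w\<in>free_on (basis F (Suc (Suc n))). ?phi v - bdry F (Suc n) w \<in> {0}"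
      if v: "v \<in> free_on (basis F (Suc n))" for v
    proof -
      have "bdry F n (?phi v) = 0"
        using uc[OF v] hc[OF v] module_hom.diff[OF graded_homD(1)[OF dh]] by simp
      then have "?phi v \<in> syz I F (Suc n)" using graded_homD(2)[OF phi v] by simp
      then obtain w where "w \<in> free_on (basis F (Suc (Suc n)))" "?phi v = bdry F (Suc n) w"
        using resolution_bdry(2)[OF F, of "Suc n"] by blast
      then show ?thesis by auto
    qed
    with graded_lift[OF phi dh graded_sub_zero]
    obtain h' where h': "graded_hom (basis F (Suc n)) (bdeg F (Suc n)) (basis F (Suc (Suc n)))
          (bdeg F (Suc (Suc n))) h'"
      "\<And>v. v \<in> free_on (basis F (Suc n)) \<Longrightarrow> ?phi v - bdry F (Suc n) (h' v) \<in> {0}"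
      by blast
    have Q: "Q n h h'" unfolding Q_def
    proof
      fix v :: "('n, 'k) fvec" assume "v \<in> free_on (basis F (Suc n))"
      from h'(2)[OF this] show "u (Suc n) v = bdry F (Suc n) (h' v) + h (bdry F n v)"
        by (simp add: algebra_simps)
    qed
    have "h 0 = 0" using module_hom.zero[OF graded_homD(1)[OF hh]] .
    then have "bdry F (Suc n) (h' (bdry F (Suc n) v)) = u (Suc n) (bdry F (Suc n) v)"
      if v: "v \<in> free_on (basis F (Suc (Suc n)))" for v
      using Q graded_homD(2)[OF dh v] bdry_bdry[OF F v] by (simp add: Q_def)
    then have "P (Suc n) h'" using h'(1) by (simp add: P_def)
    with Q show "\<exists>h'. P (Suc n) h' \<and> Q n h h'" by blast
  qed
  then obtain h where h: "\<And>n. P n (h n)" "\<And>n. Q n (h n) (h (Suc n))" by blast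
  show thesis
    by (rule that[of h]) (use h in \<open>auto simp: P_def Q_def\<close>)
qed

section \<open>Independence of Tor from the resolution\<close>

text \<open>Exponents are natural numbers, so a sum of two vanishes only if both do. Constant
  coefficients thus form a ring homomorphism onto the field.\<close>

lemma lookup_mult_zero:
  "lookup (p * q) 0 = lookup p 0 * lookup (q :: ('n, 'k::field) mpoly) 0"
proof -
  have eq: "(0 = l + r) \<longleftrightarrow> (l = 0 \<and> r = 0)" for l r :: "'n \<Rightarrow>\<^sub>0 nat"
    by (auto simp: poly_mapping_eq_iff fun_eq_iff lookup_add)
  have "(\<Sum>r. lookup q r when 0 = l + r) = (lookup q 0 when l = 0)" for l
    by (cases "l = 0") (simp_all add: eq)
  then show ?thesis
    by (simp add: lookup_mult mult_when)
qed

lemma lookup_residue: "lookup (residue v) b = lookup (lookup v b) 0"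
  by (simp add: residue_def lookup_map_zero)

lemma lookup_const_vec: "lookup (const_vec v) b = Const (lookup v b)"
  by (simp add: const_vec_def lookup_map_zero Const_def)

lemma residue_add: "residue (v + w) = residue v + residue w"
  by (rule poly_mapping_eqI) (simp add: lookup_residue lookup_add)

lemma residue_zero [simp]: "residue 0 = 0"
  by (rule poly_mapping_eqI) (simp add: lookup_residue)

lemma residue_smult: "residue (smult p v) = smult (lookup p 0) (residue v)"
  by (rule poly_mapping_eqI) (simp add: lookup_residue lookup_mult_zero)

lemma residue_sum: "residue (sum f A) = (\<Sum>x\<in>A. residue (f x))"
  by (induction A rule: infinite_finite_induct) (auto simp: residue_add)

lemma residue_const_vec [simp]: "residue (const_vec v) = v"
  by (rule poly_mapping_eqI) (simp add: lookup_residue lookup_const_vec Const_def)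

lemma residue_hom:
  assumes "module_hom smult smult D"
  shows "residue (D v) = lin (\<lambda>b. residue (D (single b 1))) (residue v)"
proof -
  have "keys (residue v) \<subseteq> keys v" by (auto simp: in_keys_iff lookup_residue)
  then show ?thesis
    by (subst hom_eq_lin[OF assms])
       (simp add: lin_def[of _ v] residue_sum residue_smult lin_superset[of "keys v"] lookup_residue)
qed

text \<open>The tensor product of \<open>D\<close> with the residue field. It extends
  \<open>tensor_bdry\<close> to chain maps and homotopies.\<close>

definition red :: "(('n, 'k::field) fvec \<Rightarrow> ('n, 'k) fvec) \<Rightarrow> (nat \<Rightarrow>\<^sub>0 'k) \<Rightarrow> (nat \<Rightarrow>\<^sub>0 'k)" where
  "red D v = residue (D (const_vec v))"

lemma red_eq_lin:
  "module_hom smult smult D \<Longrightarrow> red D v = lin (\<lambda>b. residue (D (single b 1))) v"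
  unfolding red_def using residue_hom[of D "const_vec v"] by simp

text \<open>Naturality of tensoring with the residue field; it takes the place of a rule for
  composites of \<open>red\<close>.\<close>

lemma red_residue: "module_hom smult smult D \<Longrightarrow> red D (residue v) = residue (D v)"
  by (simp add: red_eq_lin residue_hom[symmetric])

lemma module_hom_red:
  assumes "module_hom smult smult D"
  shows "module_hom smult smult (red D)"
proof -
  have "red D = lin (\<lambda>b. residue (D (single b 1)))"
    by (rule ext, rule red_eq_lin[OF assms])
  then show ?thesis by (simp only: module_hom_lin)
qed

lemma const_vec_free_on: "v \<in> free_on B \<Longrightarrow> const_vec v \<in> free_on B"
  by (auto simp: mem_free_on lookup_const_vec Const_def)

text \<open>In a homogeneous vector of degree \<open>j\<close>, a nonzero constant coefficient can
  occur only at basis elements of degree \<open>j\<close>.\<close>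

lemma red_degree:
  assumes D: "graded_hom B d B' d' D" and v: "v \<in> free_on {b \<in> B. d b = j}"
  shows "red D v \<in> free_on {b \<in> B'. d' b = j}"
proof -
  have cv: "const_vec v \<in> free_on B" "vhomogeneous d j (const_vec v)"
    using v by (auto intro!: const_vec_free_on vhomogeneous_const_vec simp: mem_free_on lookup_const_vec Const_def)
  have "D (const_vec v) \<in> free_on B'" "vhomogeneous d' j (D (const_vec v))"
    using graded_homD(2,3)[OF D] cv by auto
  then show ?thesis
    unfolding red_def by (force simp: mem_free_on lookup_residue vhomogeneous_iff)
qed

lemma tensor_bdry_eq_red: "tensor_bdry F i v = red (bdry F i) v"
  by (simp add: tensor_bdry_def red_def)

section \<open>Dimensions of quotients through complements\<close>

definition complement :: "(nat \<Rightarrow>\<^sub>0 'k::field) set \<Rightarrow> (nat \<Rightarrow>\<^sub>0 'k) set \<Rightarrow> (nat \<Rightarrow>\<^sub>0 'k) set \<Rightarrow> bool" where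
  "complement Z W S \<longleftrightarrow> S \<subseteq> Z \<and> \<not> module.dependent smult S \<and>
     module.span smult S \<inter> W = {0} \<and> module.span smult (S \<union> W) = Z"

text \<open>Extend a basis \<open>A\<close> of \<open>W\<close> to a basis \<open>B\<close> of
  \<open>Z\<close> and take \<open>B - A\<close>.\<close>

lemma complement_exists:
  fixes Z W :: "(nat \<Rightarrow>\<^sub>0 'k::field) set"
  assumes Z: "fm.subspace Z" and W: "fm.subspace W" and WZ: "W \<subseteq> Z"
  shows "\<exists>S. complement Z W S"
proof -
  obtain A where A: "A \<subseteq> W" "fm.independent A" "W \<subseteq> fm.span A"
    using vs.maximal_independent_subset by metis
  obtain B where B: "A \<subseteq> B" "B \<subseteq> Z" "fm.independent B" "Z \<subseteq> fm.span B"
    using vs.maximal_independent_subset_extend[of A Z] A WZ by (metis order_trans)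
  have spA: "fm.span A = W"
    using A W fm.span_minimal by blast
  \<comment> \<open>The coordinates of \<open>x\<close> with respect to \<open>B\<close> are
    supported both in \<open>A\<close> and in \<open>B - A\<close>, hence vanish.\<close>
  have "x = 0" if x: "x \<in> fm.span (B - A)" "x \<in> fm.span A" for x
  proof -
    have "fm.representation B x = fm.representation A x"
      "fm.representation B x = fm.representation (B - A) x"
      using fm.representation_extend B x by auto
    then have "fm.representation A x b = 0" for b
      using fm.representation_ne_zero[of A x b] fm.representation_ne_zero[of "B - A" x b] by auto
    then show "x = 0"
      using fm.sum_nonzero_representation_eq[OF A(2) x(2)] by simp
  qed
  then have "fm.span (B - A) \<inter> W = {0}"
    using spA fm.span_zero fm.subspace_0[OF W] by blast
  moreover have "fm.span ((B - A) \<union> W) = Z"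
  proof
    show "fm.span ((B - A) \<union> W) \<subseteq> Z"
      using B WZ Z by (intro fm.span_minimal) auto
    have "B \<subseteq> (B - A) \<union> W" using A by blast
    then show "Z \<subseteq> fm.span ((B - A) \<union> W)" using B(4) fm.span_mono by blast
  qed
  ultimately show ?thesis
    unfolding complement_def using B fm.independent_mono[OF B(3), of "B - A"] by blast
qed

text \<open>The hypothesis \<open>inj\<close> expresses injectivity modulo \<open>W'\<close>. The
  map is corrected by elements of \<open>W'\<close> to a linear map from the span of
  \<open>S\<close> into the span of \<open>S'\<close>, whose injectivity bounds the
  cardinality.\<close>

lemma complement_card_le:
  fixes f :: "(nat \<Rightarrow>\<^sub>0 'k::field) \<Rightarrow> (nat \<Rightarrow>\<^sub>0 'k)"
  assumes f: "module_hom smult smult f" and fZ: "f ` Z \<subseteq> Z'" and Z: "fm.subspace Z" and W': "fm.subspace W'"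
    and inj: "\<And>z. z \<in> Z \<Longrightarrow> f z \<in> W' \<Longrightarrow> z \<in> W"
    and S: "complement Z W S" and S': "complement Z' W' S'" and fin: "finite S'"
  shows "finite S \<and> card S \<le> card S'"
proof -
  note S = S[unfolded complement_def] and S' = S'[unfolded complement_def]
  have spW': "fm.span W' = W'" using W' by simp
  have "\<exists>y. y \<in> fm.span S' \<and> f s - y \<in> W'" if "s \<in> S" for s
  proof -
    have "f s \<in> fm.span (S' \<union> W')" using S S' fZ that by blast
    then obtain y w where "f s = y + w" "y \<in> fm.span S'" "w \<in> W'"
      unfolding fm.span_Un spW' by blast
    then show ?thesis by (intro exI[of _ y]) auto
  qed
  then obtain a where a: "\<And>s. s \<in> S \<Longrightarrow> a s \<in> fm.span S' \<and> f s - a s \<in> W'" by metis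
  \<comment> \<open>\<open>a s\<close> is the part of \<open>f s\<close> in the span of
    \<open>S'\<close>; independence of \<open>S\<close> extends \<open>a\<close> linearly, and then
    \<open>g\<close> agrees with \<open>f\<close> modulo \<open>W'\<close> on the whole
    span.\<close>
  obtain g where g: "Vector_Spaces.linear smult smult g" "\<forall>x\<in>S. g x = a x"
    using vsp.linear_independent_extend[of S a] S by blast
  interpret f: module_hom smult smult f by fact
  interpret g: module_hom smult smult g using g(1) by (simp add: module_hom_iff_linear)
  have diff: "f z - g z \<in> W'" if "z \<in> fm.span S" for z
    using that
  proof (induction rule: fm.span_induct_alt)
    case base
    show ?case using fm.subspace_0[OF W'] by simp
  next
    case (step c x y)
    have "f (smult c x + y) - g (smult c x + y) = smult c (f x - g x) + (f y - g y)"
      by (simp add: f.add g.add f.scale g.scale algebra_simps fm.scale_right_diff_distrib)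
    moreover have "f x - g x \<in> W'" using a g(2) step(1) by simp
    ultimately show ?case using step(2) W' by (simp add: fm.subspace_add fm.subspace_scale)
  qed
  have SZ: "fm.span S \<subseteq> Z" using S Z by (intro fm.span_minimal) auto
  have "z = 0" if z: "z \<in> fm.span S" "g z = 0" for z
  proof -
    have "f z \<in> W'" using diff[OF z(1)] z(2) by simp
    then have "z \<in> W" using inj SZ z(1) by blast
    then show "z = 0" using S z(1) by blast
  qed
  then have ginj: "inj_on g (fm.span S)"
    by (subst g.inj_on_iff_eq_0) auto
  then have "fm.independent (g ` S)"
    using g.independent_injective_image S by blast
  moreover have "g ` S \<subseteq> fm.span S'" using a g(2) by auto
  ultimately have "finite (g ` S) \<and> card (g ` S) \<le> card S'"
    by (rule vs.independent_span_bound[OF fin])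
  moreover have "inj_on g S" using ginj fm.span_superset inj_on_subset by blast
  ultimately show ?thesis by (simp add: card_image finite_image_iff)
qed

section \<open>Tor and its behaviour under chain maps\<close>

lemma tensor_part_free_on:
  fixes F :: "('n, 'k::field) free_complex"
  shows "v \<in> tensor_part F i j \<Longrightarrow> (const_vec v :: ('n, 'k) fvec) \<in> free_on (basis F i)"
  unfolding tensor_part_def by (intro const_vec_free_on) (auto simp: mem_free_on)

lemma tor_cycles_tensor_part: "tor_cycles F i j \<subseteq> tensor_part F i j"
  by (cases i) (auto simp: tor_cycles_def)

lemma tor_subspaces:
  assumes F: "graded_free_resolution I F"
  shows "fm.subspace (tor_cycles F i j)" "fm.subspace (tor_boundaries F i j)"
    "tor_boundaries F i j \<subseteq> tor_cycles F i j"
proof -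
  have dh: "module_hom smult smult (bdry F i)" for i
    using graded_homD(1)[OF resolution_bdry(1)[OF F]] .
  have red: "module_hom smult smult (red (bdry F i))" for i
    by (rule module_hom_red[OF dh])
  show "fm.subspace (tor_cycles F i j)"
  proof (cases i)
    case 0
    then show ?thesis by (simp add: tor_cycles_def tensor_part_def subspace_free_on)
  next
    case (Suc k)
    have "fm.subspace (free_on {b \<in> basis F (Suc k). bdeg F (Suc k) b = j} \<inter> {v. red (bdry F k) v = 0})"
      by (intro fm.subspace_inter subspace_free_on module_hom.subspace_kernel[OF red])
    then show ?thesis
      using Suc by (simp add: tor_cycles_def tensor_part_def tensor_bdry_eq_red Int_def)
  qed
  show "fm.subspace (tor_boundaries F i j)"
    unfolding tor_boundaries_def tensor_part_def tensor_bdry_eq_red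
    by (rule module_hom.subspace_image[OF red subspace_free_on])
  show "tor_boundaries F i j \<subseteq> tor_cycles F i j"
  proof
    fix w assume "w \<in> tor_boundaries F i j"
    then obtain v where v: "v \<in> tensor_part F (Suc i) j" "w = red (bdry F i) v"
      by (auto simp: tor_boundaries_def tensor_bdry_eq_red)
    have "w \<in> tensor_part F i j"
      using v red_degree[OF resolution_bdry(1)[OF F]] by (auto simp: tensor_part_def)
    moreover have "red (bdry F k) w = 0" if "i = Suc k" for k
      using tensor_part_free_on[OF v(1)] unfolding v(2) that
      by (simp add: red_def[of "bdry F (Suc k)"] red_residue[OF dh] bdry_bdry[OF F])
    ultimately show "w \<in> tor_cycles F i j"
      by (cases i) (auto simp: tor_cycles_def tensor_bdry_eq_red)
  qed
qed

lemma chain_map_red: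
  assumes F: "graded_free_resolution I F" and G: "graded_free_resolution I G" and f: "chain_map F G f"
    and v: "v \<in> tensor_part F (Suc i) j"
  shows "red (bdry G i) (red (f (Suc i)) v) = red (f i) (red (bdry F i) v)"
proof -
  have h: "module_hom smult smult (bdry G i)" "module_hom smult smult (f i)"
    using graded_homD(1) resolution_bdry(1)[OF G] chain_mapD(1)[OF f] by blast+
  have "red (bdry G i) (red (f (Suc i)) v) = residue (bdry G i (f (Suc i) (const_vec v)))"
    by (simp add: red_def[of "f (Suc i)"] red_residue[OF h(1)])
  also have "\<dots> = residue (f i (bdry F i (const_vec v)))"
    using chain_mapD(2)[OF f tensor_part_free_on[OF v]] by simp
  also have "\<dots> = red (f i) (red (bdry F i) v)"
    by (simp add: red_def[of "bdry F i"] red_residue[OF h(2)])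
  finally show ?thesis .
qed

lemma chain_map_red_degree:
  "chain_map F G f \<Longrightarrow> v \<in> tensor_part F i j \<Longrightarrow> red (f i) v \<in> tensor_part G i j"
  unfolding tensor_part_def by (rule red_degree[OF chain_mapD(1)])

lemma chain_map_tor_cycles:
  assumes F: "graded_free_resolution I F" and G: "graded_free_resolution I G" and f: "chain_map F G f"
    and v: "v \<in> tor_cycles F i j"
  shows "red (f i) v \<in> tor_cycles G i j"
proof (cases i)
  case 0
  then show ?thesis using v chain_map_red_degree[OF f] by (simp add: tor_cycles_def)
next
  case (Suc k)
  have "red (f k) 0 = 0"
    using module_hom.zero[OF module_hom_red[OF graded_homD(1)[OF chain_mapD(1)[OF f]]]] .
  moreover have v': "v \<in> tensor_part F (Suc k) j" "red (bdry F k) v = 0"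
    using v Suc by (auto simp: tor_cycles_def tensor_bdry_eq_red)
  ultimately show ?thesis
    using Suc chain_map_red_degree[OF f v'(1)] chain_map_red[OF F G f v'(1)]
    by (simp add: tor_cycles_def tensor_bdry_eq_red)
qed

lemma chain_map_tor_boundaries:
  assumes F: "graded_free_resolution I F" and G: "graded_free_resolution I G" and f: "chain_map F G f"
    and v: "v \<in> tor_boundaries F i j"
  shows "red (f i) v \<in> tor_boundaries G i j"
  using v chain_map_red_degree[OF f] chain_map_red[OF F G f, symmetric]
  by (auto simp: tor_boundaries_def tensor_bdry_eq_red)

text \<open>Comparison maps \<open>f\<close> and \<open>g\<close> exist in both directions, and
  \<open>g\<close> after \<open>f\<close> is homotopic to the identity. Hence \<open>f\<close> is
  injective on Tor. This one-sided bound, with finiteness included, suffices by symmetry.\<close>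

lemma tor_complement_card_le:
  fixes I :: "('n::finite, 'k::field) mpoly set"
  assumes hI: "homogeneous_ideal I"
    and F: "graded_free_resolution I F" and G: "graded_free_resolution I G"
    and S: "complement (tor_cycles F i j) (tor_boundaries F i j) S"
    and T: "complement (tor_cycles G i j) (tor_boundaries G i j) T" "finite T"
  shows "finite S \<and> card S \<le> card T"
proof -
  note sI = homogeneous_ideal_subspace[OF hI]
  obtain f where f: "chain_map F G f"
    and f0: "\<And>v. v \<in> free_on (basis F 0) \<Longrightarrow> aug F v - aug G (f 0 v) \<in> I"
    using comparison_map[OF hI F G] by blast
  obtain g where g: "chain_map G F g"
    and g0: "\<And>v. v \<in> free_on (basis G 0) \<Longrightarrow> aug G v - aug F (g 0 v) \<in> I"
    using comparison_map[OF hI G F] by blast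
  define u where "u i v = v - g i (f i v)" for i v
  have gf: "chain_map F F (\<lambda>i v. g i (f i v))" by (rule chain_map_compose[OF f g])
  have dh: "module_hom smult smult (bdry F i)" for i
    using graded_homD(1)[OF resolution_bdry(1)[OF F]] .
  have u: "chain_map F F u"
    using gf unfolding chain_map_def u_def
    by (auto intro!: graded_hom_diff graded_hom_id simp: module_hom.diff[OF dh])
  note augh = resolution_aug_hom[OF F]
  have u0: "u 0 v \<in> syz I F 0" if v: "v \<in> free_on (basis F 0)" for v
  proof -
    have "aug F v - aug F (g 0 (f 0 v)) \<in> I"
      using rg.subspace_add[OF sI f0[OF v] g0[OF graded_homD(2)[OF chain_mapD(1)[OF f] v]]] by simp
    then show ?thesis
      using graded_homD(2)[OF chain_mapD(1)[OF u] v]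
      by (simp add: u_def module_hom.diff[OF augh])
  qed
  obtain h where h: "\<And>i. graded_hom (basis F i) (bdeg F i) (basis F (Suc i)) (bdeg F (Suc i)) (h i)"
    and h0: "\<And>v. v \<in> free_on (basis F 0) \<Longrightarrow> u 0 v = bdry F 0 (h 0 v)"
    and hS: "\<And>i v. v \<in> free_on (basis F (Suc i)) \<Longrightarrow>
      u (Suc i) v = bdry F (Suc i) (h (Suc i) v) + h i (bdry F i v)"
    using null_homotopy[OF F u u0] by blast
  have hom: "module_hom smult smult (h i)" "module_hom smult smult (g i)"
    "module_hom smult smult (f i)" for i
    using graded_homD(1) h chain_mapD(1)[OF g] chain_mapD(1)[OF f] by blast+
  have red_u: "z - red (g i) (red (f i) z) \<in> tor_boundaries F i j" if z: "z \<in> tor_cycles F i j" for z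
  proof -
    have zt: "z \<in> tensor_part F i j" using z tor_cycles_tensor_part by blast
    note cz = tensor_part_free_on[OF zt]
    have rd: "residue (v - w) = residue v - residue w" for v w :: "('n, 'k) fvec"
      by (metis add_diff_cancel diff_add_cancel residue_add)
    have "z - red (g i) (red (f i) z) = residue (u i (const_vec z))"
      by (simp add: u_def red_def[of "f i"] red_residue[OF hom(2)] rd)
    also have "\<dots> = residue (bdry F i (h i (const_vec z)))"
    proof (cases i)
      case 0
      then show ?thesis using h0 cz by simp
    next
      case (Suc k)
      \<comment> \<open>The homotopy has a second term, through \<open>bdry F k\<close>; it
        disappears after reduction because \<open>z\<close> is a cycle there.\<close>
      have "red (bdry F k) z = 0" using z Suc by (simp add: tor_cycles_def tensor_bdry_eq_red)
      then have "residue (h k (bdry F k (const_vec z))) = 0"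
        using module_hom.zero[OF module_hom_red[OF hom(1)]]
        by (simp add: red_residue[OF hom(1), symmetric] red_def[of "bdry F k", symmetric])
      then show ?thesis using hS[of "const_vec z" k] cz Suc by (simp add: residue_add)
    qed
    also have "\<dots> = red (bdry F i) (red (h i) z)"
      by (simp add: red_def[of "h i"] red_residue[OF dh])
    finally show ?thesis
      using red_degree[OF h] zt
      by (auto simp: tor_boundaries_def tensor_bdry_eq_red tensor_part_def)
  qed
  show ?thesis
  proof (rule complement_card_le[OF module_hom_red[OF hom(3)] _ tor_subspaces(1)[OF F]
        tor_subspaces(2)[OF G] _ S T])
    show "red (f i) ` tor_cycles F i j \<subseteq> tor_cycles G i j"
      using chain_map_tor_cycles[OF F G f] by blast
    fix z assume z: "z \<in> tor_cycles F i j" "red (f i) z \<in> tor_boundaries G i j"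
    \<comment> \<open>Both summands are boundaries: the first by the homotopy, the second as the
      image of a boundary of \<open>G\<close>.\<close>
    have "(z - red (g i) (red (f i) z)) + red (g i) (red (f i) z) \<in> tor_boundaries F i j"
      by (intro fm.subspace_add tor_subspaces(2)[OF F] red_u z(1) chain_map_tor_boundaries[OF G F g] z(2))
    then show "z \<in> tor_boundaries F i j" by simp
  qed
qed

text \<open>If either chosen complement is finite, the two bounds make both finite of equal size;
  otherwise both have \<open>card\<close> 0.\<close>

theorem tor_dim_unique:
  fixes I :: "('n::finite, 'k::field) mpoly set"
  assumes hI: "homogeneous_ideal I"
    and F: "graded_free_resolution I F" and G: "graded_free_resolution I G"
  shows "quotient_dim (tor_cycles F i j) (tor_boundaries F i j) =
         quotient_dim (tor_cycles G i j) (tor_boundaries G i j)"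
proof -
  have ex: "\<exists>S. complement (tor_cycles H i j) (tor_boundaries H i j) S"
    if "graded_free_resolution I H" for H
    by (intro complement_exists tor_subspaces[OF that])
  define S where "S = (SOME S. complement (tor_cycles F i j) (tor_boundaries F i j) S)"
  define T where "T = (SOME S. complement (tor_cycles G i j) (tor_boundaries G i j) S)"
  have S: "complement (tor_cycles F i j) (tor_boundaries F i j) S"
    unfolding S_def by (rule someI_ex[OF ex[OF F]])
  have T: "complement (tor_cycles G i j) (tor_boundaries G i j) T"
    unfolding T_def by (rule someI_ex[OF ex[OF G]])
  have "card S = card T"
    using tor_complement_card_le[OF hI F G S T] tor_complement_card_le[OF hI G F T S]
    by (cases "finite S"; cases "finite T") auto
  then show ?thesis
    by (simp add: quotient_dim_def S_def T_def complement_def)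
qed

section \<open>Base change along the substitution\<close>

text \<open>Reduces additive identities to monomials; \<open>P 0\<close> is the monomial case with
  coefficient 0.\<close>

lemma poly_mapping_add_induct [case_names single add]:
  assumes "\<And>k c. P (single k c)" "\<And>p q. P p \<Longrightarrow> P q \<Longrightarrow> P (p + q)"
  shows "P (p :: 'a \<Rightarrow>\<^sub>0 'b::comm_monoid_add)"
proof -
  have "P 0" using assms(1)[of undefined 0] by simp
  then have "P (\<Sum>k\<in>A. single k (lookup p k))" for A
    by (induction A rule: infinite_finite_induct) (auto intro: assms)
  then show ?thesis using sum_singles[of p] by metis
qed

section \<open>Division of exponent vectors by m\<close>

definition expo_scale :: "nat \<Rightarrow> ('n \<Rightarrow>\<^sub>0 nat) \<Rightarrow> ('n \<Rightarrow>\<^sub>0 nat)" where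
  "expo_scale m t = Poly_Mapping.map ((*) m) t"

definition expo_div :: "nat \<Rightarrow> ('n \<Rightarrow>\<^sub>0 nat) \<Rightarrow> ('n \<Rightarrow>\<^sub>0 nat)" where
  "expo_div m t = Poly_Mapping.map (\<lambda>k. k div m) t"

definition expo_mod :: "nat \<Rightarrow> ('n \<Rightarrow>\<^sub>0 nat) \<Rightarrow> ('n \<Rightarrow>\<^sub>0 nat)" where
  "expo_mod m t = Poly_Mapping.map (\<lambda>k. k mod m) t"

definition digits :: "nat \<Rightarrow> ('n \<Rightarrow>\<^sub>0 nat) set" where
  "digits m = {r. \<forall>x. lookup r x < m}"

lemma lookup_expo [simp]:
  "lookup (expo_scale m t) x = m * lookup t x"
  "lookup (expo_div m t) x = lookup t x div m"
  "lookup (expo_mod m t) x = lookup t x mod m"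
  by (simp_all add: expo_scale_def expo_div_def expo_mod_def lookup_map_zero)

lemma expo_scale_zero [simp]: "expo_scale m 0 = 0"
  by (rule poly_mapping_eqI) simp

lemma expo_scale_add: "expo_scale m (s + t) = expo_scale m s + expo_scale m t"
  by (rule poly_mapping_eqI) (simp add: lookup_add algebra_simps)

lemma expo_div_mod: "expo_scale m (expo_div m s) + expo_mod m s = s"
  by (rule poly_mapping_eqI) (simp add: lookup_add)

lemma mdeg_expo_scale: "mdeg (expo_scale m t) = m * mdeg t"
  by (simp add: mdeg_def sum_distrib_left)

lemma finite_digits: "finite (digits m :: ('n::finite \<Rightarrow>\<^sub>0 nat) set)"
proof -
  have "lookup ` (digits m :: ('n \<Rightarrow>\<^sub>0 nat) set) \<subseteq>
      {f. \<forall>x. (x \<in> UNIV \<longrightarrow> f x \<in> {..<m}) \<and> (x \<notin> UNIV \<longrightarrow> f x = 0)}"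
    by (auto simp: digits_def)
  moreover have "finite {f :: 'n \<Rightarrow> nat. \<forall>x. (x \<in> UNIV \<longrightarrow> f x \<in> {..<m}) \<and> (x \<notin> UNIV \<longrightarrow> f x = 0)}"
    by (rule finite_set_of_finite_funs) auto
  ultimately have "finite (lookup ` (digits m :: ('n \<Rightarrow>\<^sub>0 nat) set))"
    by (rule finite_subset)
  then show ?thesis
    by (rule finite_imageD) (simp add: inj_on_def lookup_inject)
qed

section \<open>The substitution as a ring homomorphism\<close>

lemma subst_power_eq:
  fixes p :: "('n::finite, 'k::field) mpoly"
  shows "subst_power m p = (\<Sum>t\<in>keys p. single (expo_scale m t) (lookup p t))"
proof -
  have pow: "single (single x a) (1::'k) ^ k = single (single x (a * k)) 1" for x :: 'n and a k :: nat
    by (induction k) (simp_all add: mult_single single_add[symmetric])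
  have prod: "(\<Prod>x\<in>A. single (f x) (1::'k)) = single (\<Sum>x\<in>A. f x) 1"
    for A and f :: "'n \<Rightarrow> 'n \<Rightarrow>\<^sub>0 nat"
    by (induction A rule: infinite_finite_induct) (simp_all add: mult_single)
  have "(\<Sum>x\<in>UNIV. single x (m * lookup t x)) = expo_scale m t" for t :: "'n \<Rightarrow>\<^sub>0 nat"
    by (rule poly_mapping_eqI) (simp add: lookup_sum lookup_single when_def)
  then have "(\<Prod>x\<in>UNIV. (Var x ^ m) ^ lookup t x) = single (expo_scale m t) (1::'k)"
    for t :: "'n \<Rightarrow>\<^sub>0 nat"
    by (simp add: Var_def pow prod)
  then show ?thesis by (simp add: subst_power_def Const_def mult_single)
qed

lemma subst_power_single [simp]: "subst_power m (single t c) = single (expo_scale m t) c"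
  by (simp add: subst_power_eq)

lemma subst_power_zero [simp]: "subst_power m 0 = 0"
  by (simp add: subst_power_eq)

lemma subst_power_add: "subst_power m (p + q) = subst_power m p + subst_power m q"
  unfolding subst_power_eq by (rule setsum_keys_plus_distrib) (simp_all add: single_add)

lemma subst_power_mult: "subst_power m (p * q) = subst_power m p * subst_power m q"
proof (induction p rule: poly_mapping_add_induct)
  case (single s a)
  show ?case
  proof (induction q rule: poly_mapping_add_induct)
    case (single t b)
    show ?case by (simp add: mult_single expo_scale_add)
  next
    case (add q q')
    then show ?case by (simp add: subst_power_add distrib_left)
  qed
next
  case (add p p')
  then show ?case by (simp add: subst_power_add distrib_right)
qed

lemma keys_subst_power: "keys (subst_power m p) \<subseteq> expo_scale m ` keys p"
proof
  fix s assume "s \<in> keys (subst_power m p)"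
  then have "(\<Sum>t\<in>keys p. lookup (single (expo_scale m t) (lookup p t)) s) \<noteq> 0"
    by (simp add: in_keys_iff subst_power_eq lookup_sum)
  then obtain t where "t \<in> keys p" "lookup (single (expo_scale m t) (lookup p t)) s \<noteq> 0"
    by (rule sum.not_neutral_contains_not_neutral)
  then show "s \<in> expo_scale m ` keys p"
    by (auto simp: lookup_single when_def split: if_splits)
qed

lemma homogeneous_subst_power: "homogeneous d p \<Longrightarrow> homogeneous (m * d) (subst_power m p)"
  using keys_subst_power[of m p] by (auto simp: homogeneous_def mdeg_expo_scale)

text \<open>Since the substitution is multiplicative, the images of homogeneous generators of
  \<open>I\<close> already generate the square power.\<close>

lemma homogeneous_ideal_square_power:
  fixes I :: "('n::finite, 'k::field) mpoly set"
  assumes "homogeneous_ideal I"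
  shows "homogeneous_ideal (square_power m I)"
proof -
  obtain S where S: "\<forall>f\<in>S. \<exists>d. homogeneous d f" and I: "I = rg.span S"
    using assms unfolding homogeneous_ideal_def ideal_gen_def by blast
  have "subst_power m p \<in> rg.span (subst_power m ` S)" if "p \<in> rg.span S" for p
    using that
  proof (induction rule: rg.span_induct_alt)
    case base
    show ?case by (simp add: rg.span_zero)
  next
    case (step c x y)
    then show ?case unfolding subst_power_add subst_power_mult
      by (intro rg.span_add rg.span_scale[OF rg.span_base]) auto
  qed
  then have "rg.span (subst_power m ` I) \<subseteq> rg.span (subst_power m ` S)"
    unfolding I by (intro rg.span_minimal) auto
  moreover have "rg.span (subst_power m ` S) \<subseteq> rg.span (subst_power m ` I)"
    unfolding I by (intro rg.span_mono image_mono rg.span_superset)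
  ultimately have "square_power m I = ideal_gen (subst_power m ` S)"
    unfolding square_power_def ideal_gen_def by blast
  moreover have "\<forall>f\<in>subst_power m ` S. \<exists>d. homogeneous d f"
    using S homogeneous_subst_power by blast
  ultimately show ?thesis unfolding homogeneous_ideal_def by blast
qed

text \<open>
  \<open>R\<close> is free over the image of \<open>subst_power m\<close>, with the monomials with exponents in \<open>digits m\<close>
  as a basis; \<open>coeff_part m r\<close> is the coordinate at the basis element \<open>r\<close>. This is the source of
  the flatness used here.
\<close>

definition coeff_part :: "nat \<Rightarrow> ('n \<Rightarrow>\<^sub>0 nat) \<Rightarrow> ('n, 'k::field) mpoly \<Rightarrow> ('n, 'k) mpoly" where
  "coeff_part m r p = Poly_Mapping.map_key (\<lambda>t. expo_scale m t + r) p"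

definition vcoeff_part :: "nat \<Rightarrow> ('n \<Rightarrow>\<^sub>0 nat) \<Rightarrow> ('n, 'k::field) fvec \<Rightarrow> ('n, 'k) fvec" where
  "vcoeff_part m r v = Poly_Mapping.map (coeff_part m r) v"

definition vsubst_power :: "nat \<Rightarrow> ('n::finite, 'k::field) fvec \<Rightarrow> ('n, 'k) fvec" where
  "vsubst_power m v = Poly_Mapping.map (subst_power m) v"

text \<open>Inverse to taking coordinates: the vector whose coordinate at the monomial
  \<open>s\<close> is \<open>w s\<close>.\<close>

definition vassemble ::
  "nat \<Rightarrow> (('n::finite \<Rightarrow>\<^sub>0 nat) \<Rightarrow> ('n, 'k::field) fvec) \<Rightarrow> ('n, 'k) fvec" where
  "vassemble m w = (\<Sum>s\<in>digits m. smult (single s 1) (vsubst_power m (w s)))"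

text \<open>The matrix of \<open>D\<close> with the substitution applied to every entry. The result
  is linear over all of \<open>R\<close>, unlike \<open>vsubst_power\<close> itself.\<close>

definition base_change ::
  "nat \<Rightarrow> (('n::finite, 'k::field) fvec \<Rightarrow> ('n, 'k) fvec) \<Rightarrow> ('n, 'k) fvec \<Rightarrow> ('n, 'k) fvec" where
  "base_change m D = lin (\<lambda>b. vsubst_power m (D (single b 1)))"

lemma lookup_vsubst_power: "lookup (vsubst_power m v) b = subst_power m (lookup v b)"
  by (simp add: vsubst_power_def lookup_map_zero)

text \<open>The substitution multiplies the degree of each matrix entry by \<open>m\<close>, which
  matches the scaling of the degrees of both bases.\<close>

lemma base_change_graded_hom:
  assumes D: "graded_hom B d B' d' D"
  shows "graded_hom B (\<lambda>b. int m * d b) B' (\<lambda>b. int m * d' b) (base_change m D)"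
  unfolding base_change_def
proof (rule graded_hom_lin)
  fix b assume b: "b \<in> B"
  then show "vsubst_power m (D (single b 1)) \<in> free_on B'"
    using graded_homD(2)[OF D single_mem_free_on[OF b]] by (auto simp: mem_free_on lookup_vsubst_power)
  have "vhomogeneous d' (d b) (D (single b 1))"
    using graded_homD(3)[OF D single_mem_free_on[OF b]] by simp
  then show "vhomogeneous (\<lambda>b. int m * d' b) (int m * d b) (vsubst_power m (D (single b 1)))"
    unfolding vhomogeneous_iff lookup_vsubst_power in_keys_iff[symmetric]
    using subsetD[OF keys_subst_power] by (fastforce simp: mdeg_expo_scale distrib_left[symmetric])
qed

section \<open>Coordinates over the subring of m-th powers, and the base-changed resolution\<close>

context
  fixes m :: nat
  assumes m: "0 < m"
begin

lemma expo_mod_digits: "expo_mod m s \<in> digits m"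
  using m by (simp add: digits_def)

lemma expo_eq_iff:
  assumes "r \<in> digits m"
  shows "s = expo_scale m t + r \<longleftrightarrow> expo_mod m s = r \<and> expo_div m s = t"
proof
  assume s: "s = expo_scale m t + r"
  show "expo_mod m s = r \<and> expo_div m s = t"
    using assms m by (auto intro!: poly_mapping_eqI simp: s lookup_add digits_def)
next
  assume "expo_mod m s = r \<and> expo_div m s = t"
  then show "s = expo_scale m t + r" using expo_div_mod[of m s] by simp
qed

lemma expo_add_scale:
  "expo_mod m (s + expo_scale m t) = expo_mod m s"
  "expo_div m (s + expo_scale m t) = expo_div m s + t"
  using m by (auto intro!: poly_mapping_eqI simp: lookup_add)

lemma inj_expo: "inj (\<lambda>t. expo_scale m t + r)"
  using m by (auto simp: inj_def poly_mapping_eq_iff fun_eq_iff lookup_add)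

lemma lookup_subst_power_zero [simp]: "lookup (subst_power m p) 0 = lookup p 0"
proof (induction p rule: poly_mapping_add_induct)
  case (single t c)
  have "expo_scale m t = 0 \<longleftrightarrow> t = 0"
    using m by (simp add: poly_mapping_eq_iff fun_eq_iff)
  then show ?case by (simp add: lookup_single when_def)
qed (simp add: subst_power_add lookup_add)

lemma lookup_coeff_part: "lookup (coeff_part m r p) t = lookup p (expo_scale m t + r)"
  by (simp add: coeff_part_def map_key.rep_eq[OF inj_expo])

lemma coeff_part_zero [simp]: "coeff_part m r 0 = 0"
  by (rule poly_mapping_eqI) (simp add: lookup_coeff_part)

lemma coeff_part_add: "coeff_part m r (p + q) = coeff_part m r p + coeff_part m r q"
  by (rule poly_mapping_eqI) (simp add: lookup_coeff_part lookup_add)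

lemma coeff_part_diff: "coeff_part m r (p - q) = coeff_part m r p - coeff_part m r q"
  by (rule poly_mapping_eqI) (simp add: lookup_coeff_part lookup_minus)

lemma coeff_part_sum: "coeff_part m r (sum f A) = (\<Sum>x\<in>A. coeff_part m r (f x))"
  by (induction A rule: infinite_finite_induct) (simp_all add: coeff_part_add)

lemma coeff_part_single:
  assumes "r \<in> digits m"
  shows "coeff_part m r (single s a) = (if expo_mod m s = r then single (expo_div m s) a else 0)"
  by (rule poly_mapping_eqI)
     (simp add: lookup_coeff_part lookup_single when_def expo_eq_iff[OF assms])

text \<open>Coordinates are linear over the image of the substitution: on monomials, adding a
  multiple of \<open>m\<close> to the exponents leaves the remainder unchanged and shifts the
  quotient.\<close>

lemma coeff_part_mult_subst_power:
  assumes r: "r \<in> digits m"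
  shows "coeff_part m r (p * subst_power m q) = coeff_part m r p * q"
proof (induction p rule: poly_mapping_add_induct)
  case (single s a)
  show ?case
  proof (induction q rule: poly_mapping_add_induct)
    case (single t b)
    show ?case by (simp add: mult_single coeff_part_single[OF r] expo_add_scale)
  next
    case (add q q')
    then show ?case by (simp add: subst_power_add coeff_part_add distrib_left)
  qed
next
  case (add p p')
  then show ?case by (simp add: coeff_part_add distrib_right)
qed

lemma coeff_part_monom_mult_subst_power:
  assumes "r \<in> digits m" "s \<in> digits m"
  shows "coeff_part m r (single s 1 * subst_power m q) = (if r = s then q else 0)"
proof -
  have "expo_mod m s = s \<and> expo_div m s = 0"
    using expo_eq_iff[OF assms(2), of s 0] by simp
  then show ?thesis
    by (auto simp: coeff_part_mult_subst_power[OF assms(1)] coeff_part_single[OF assms(1)])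
qed

lemma coeff_part_eqI:
  assumes "\<And>r. r \<in> digits m \<Longrightarrow> coeff_part m r p = coeff_part m r q"
  shows "p = q"
proof (rule poly_mapping_eqI)
  fix s
  show "lookup p s = lookup q s"
    using arg_cong[OF assms[OF expo_mod_digits], of "\<lambda>p. lookup p (expo_div m s)" s]
    by (simp add: lookup_coeff_part expo_div_mod)
qed

text \<open>The square power is the direct sum of copies of \<open>I\<close>, one for each monomial
  with exponents in \<open>digits m\<close>.\<close>

lemma square_power_iff:
  fixes I :: "('n::finite, 'k::field) mpoly set"
  assumes I: "rg.subspace I"
  shows "p \<in> square_power m I \<longleftrightarrow> (\<forall>r\<in>digits m. coeff_part m r p \<in> I)"
proof
  assume "p \<in> square_power m I"
  then have "p \<in> rg.span (subst_power m ` I)" by (simp add: square_power_def ideal_gen_def)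
  then show "\<forall>r\<in>digits m. coeff_part m r p \<in> I"
  proof (induction rule: rg.span_induct_alt)
    case base
    show ?case using rg.subspace_0[OF I] by simp
  next
    case (step c x y)
    then show ?case
      by (auto simp: coeff_part_add coeff_part_mult_subst_power intro!: rg.subspace_add[OF I]
          intro: rg.subspace_scale[OF I])
  qed
next
  assume p: "\<forall>r\<in>digits m. coeff_part m r p \<in> I"
  \<comment> \<open>Expansion of \<open>p\<close> in the monomial basis; each coordinate lies in
    \<open>I\<close>, so each term lies in the span.\<close>
  have "p = (\<Sum>s\<in>digits m. single s 1 * subst_power m (coeff_part m s p))"
    by (rule coeff_part_eqI)
       (simp add: coeff_part_sum coeff_part_monom_mult_subst_power finite_digits)
  also have "\<dots> \<in> rg.span (subst_power m ` I)"
    using p by (intro rg.span_sum rg.span_scale rg.span_base) auto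
  finally show "p \<in> square_power m I" by (simp add: square_power_def ideal_gen_def)
qed

lemma lookup_vcoeff_part: "lookup (vcoeff_part m r v) b = coeff_part m r (lookup v b)"
  by (simp add: vcoeff_part_def lookup_map_zero)

lemma vcoeff_part_eqI:
  assumes "\<And>r. r \<in> digits m \<Longrightarrow> vcoeff_part m r v = vcoeff_part m r w"
  shows "v = w"
proof (rule poly_mapping_eqI, rule coeff_part_eqI)
  show "coeff_part m r (lookup v b) = coeff_part m r (lookup w b)" if "r \<in> digits m" for r b
    using arg_cong[OF assms[OF that], of "\<lambda>v. lookup v b"] by (simp add: lookup_vcoeff_part)
qed

lemma vcoeff_part_free_on_iff:
  "v \<in> free_on B \<longleftrightarrow> (\<forall>r\<in>digits m. vcoeff_part m r v \<in> free_on B)"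
  using coeff_part_eqI[of "lookup v _" 0] unfolding mem_free_on lookup_vcoeff_part
  by (metis coeff_part_zero)

lemma vcoeff_part_vassemble:
  fixes w :: "('n::finite \<Rightarrow>\<^sub>0 nat) \<Rightarrow> ('n, 'k::field) fvec"
  assumes "r \<in> digits m"
  shows "vcoeff_part m r (vassemble m w) = w r"
  by (rule poly_mapping_eqI)
     (simp add: lookup_vcoeff_part vassemble_def lookup_sum lookup_vsubst_power coeff_part_sum
       coeff_part_monom_mult_subst_power assms finite_digits if_distrib[of "\<lambda>p. lookup p _"] cong: if_cong)

lemma vassemble_free_on:
  fixes w :: "('n::finite \<Rightarrow>\<^sub>0 nat) \<Rightarrow> ('n, 'k::field) fvec"
  assumes "\<And>s. s \<in> digits m \<Longrightarrow> w s \<in> free_on B"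
  shows "vassemble m w \<in> free_on B"
  by (subst vcoeff_part_free_on_iff) (simp add: vcoeff_part_vassemble assms)

text \<open>The heart of the exactness proof: by linearity over the subring, the base-changed map is
  \<open>D\<close> on each coordinate separately.\<close>

lemma vcoeff_part_base_change:
  assumes D: "module_hom smult smult D" and r: "r \<in> digits m"
  shows "vcoeff_part m r (base_change m D v) = D (vcoeff_part m r v)"
proof -
  have "keys (vcoeff_part m r v) \<subseteq> keys v" by (auto simp: in_keys_iff lookup_vcoeff_part)
  then have "D (vcoeff_part m r v) =
      (\<Sum>b\<in>keys v. smult (coeff_part m r (lookup v b)) (D (single b 1)))"
    by (subst hom_eq_lin[OF D]) (simp add: lin_superset[of "keys v"] lookup_vcoeff_part)
  then show ?thesis
    by (intro poly_mapping_eqI)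
       (simp add: base_change_def lin_def lookup_vcoeff_part lookup_sum lookup_vsubst_power
         coeff_part_sum coeff_part_mult_subst_power[OF r])
qed

text \<open>Preimages found for the single coordinates are assembled into one vector. The predicate
  \<open>P\<close> covers both exactness conditions: augmentation in \<open>I\<close>, and boundary
  0.\<close>

lemma base_change_image:
  fixes D :: "('n::finite, 'k::field) fvec \<Rightarrow> ('n, 'k) fvec"
  assumes D: "module_hom smult smult D" and im: "D ` free_on C = {v \<in> free_on B. P v}"
  shows "base_change m D ` free_on C = {v \<in> free_on B. \<forall>r\<in>digits m. P (vcoeff_part m r v)}"
proof (intro equalityI subsetI)
  fix v assume "v \<in> base_change m D ` free_on C"
  then obtain w where w: "w \<in> free_on C" "v = base_change m D w" by blast
  have "vcoeff_part m r v \<in> free_on B \<and> P (vcoeff_part m r v)" if r: "r \<in> digits m" for r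
    using w im vcoeff_part_free_on_iff[of w C] r by (auto simp: vcoeff_part_base_change[OF D r])
  then show "v \<in> {v \<in> free_on B. \<forall>r\<in>digits m. P (vcoeff_part m r v)}"
    using vcoeff_part_free_on_iff[of v B] by blast
next
  fix v assume v: "v \<in> {v \<in> free_on B. \<forall>r\<in>digits m. P (vcoeff_part m r v)}"
  have "\<forall>r\<in>digits m. \<exists>w. w \<in> free_on C \<and> D w = vcoeff_part m r v"
  proof
    fix r :: "'n \<Rightarrow>\<^sub>0 nat" assume r: "r \<in> digits m"
    have "vcoeff_part m r v \<in> {v \<in> free_on B. P v}"
      using v r vcoeff_part_free_on_iff[of v B] by blast
    then show "\<exists>w. w \<in> free_on C \<and> D w = vcoeff_part m r v"
      unfolding im[symmetric] by auto
  qed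
  from bchoice[OF this] obtain w
    where w: "\<forall>r\<in>digits m. w r \<in> free_on C \<and> D (w r) = vcoeff_part m r v" ..
  have "base_change m D (vassemble m w) = v"
    by (rule vcoeff_part_eqI) (simp add: vcoeff_part_base_change[OF D] vcoeff_part_vassemble w)
  then show "v \<in> base_change m D ` free_on C"
    using vassemble_free_on[of w C] w by blast
qed

lemma base_change_eq_zero_iff:
  assumes D: "module_hom smult smult D"
  shows "base_change m D v = 0 \<longleftrightarrow> (\<forall>r\<in>digits m. D (vcoeff_part m r v) = 0)"
proof -
  have z: "vcoeff_part m r 0 = 0" for r :: "'a \<Rightarrow>\<^sub>0 nat"
    by (rule poly_mapping_eqI) (simp add: lookup_vcoeff_part)
  show ?thesis
    using vcoeff_part_eqI[of "base_change m D v" 0]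
    by (auto simp: vcoeff_part_base_change[OF D, symmetric] z)
qed

text \<open>The augmentation passes through the free module on \<open>{0}\<close> so that
  \<open>base_change\<close> applies to it as well.\<close>

definition base_change_complex :: "('n::finite, 'k::field) free_complex \<Rightarrow> ('n, 'k) free_complex" where
  "base_change_complex F = \<lparr>basis = basis F, bdeg = (\<lambda>i b. int m * bdeg F i b),
     bdry = (\<lambda>i. base_change m (bdry F i)),
     aug = (\<lambda>v. lookup (base_change m (\<lambda>w. single 0 (aug F w)) v) 0)\<rparr>"

theorem base_change_resolution:
  fixes I :: "('n::finite, 'k::field) mpoly set"
  assumes I: "rg.subspace I" and F: "graded_free_resolution I F"
  shows "graded_free_resolution (square_power m I) (base_change_complex F)"
proof -
  let ?E = "\<lambda>w. single (0::nat) (aug F w)"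
  let ?A = "\<lambda>v. lookup (base_change m ?E v) 0"
  note dh = resolution_bdry(1)[OF F]
  note dm = graded_homD(1)[OF dh]
  note Eh = resolution_aug[OF F]
  have A: "coeff_part m r (?A v) = aug F (vcoeff_part m r v)" if "r \<in> digits m" for r v
    using arg_cong[OF vcoeff_part_base_change[OF graded_homD(1)[OF Eh] that, of v], of "\<lambda>v. lookup v 0"]
    by (simp add: lookup_vcoeff_part)
  show ?thesis
    unfolding graded_free_resolution_def base_change_complex_def free_complex.simps
  proof (intro conjI allI ballI impI)
    show "module_hom smult smult (base_change m (bdry F i))" for i
      unfolding base_change_def by (rule module_hom_lin)
    show "vhomogeneous (\<lambda>b. int m * bdeg F i b) j (base_change m (bdry F i) v)"
      if "v \<in> free_on (basis F (Suc i))" "vhomogeneous (\<lambda>b. int m * bdeg F (Suc i) b) j v" for i j v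
      using graded_homD(3)[OF base_change_graded_hom[OF dh]] that by blast
    show "module_hom smult (*) ?A"
      using module_hom_compose[OF module_hom_lin module_hom_lookup] by (simp add: o_def base_change_def)
    show "int (mdeg t) = j"
      if "v \<in> free_on (basis F 0)" "vhomogeneous (\<lambda>b. int m * bdeg F 0 b) j v" "t \<in> keys (?A v)"
      for j v t
      using graded_homD(3)[OF base_change_graded_hom[OF Eh] that(1,2)] that(3)
      by (auto simp: vhomogeneous_iff in_keys_iff)
    show "\<exists>v\<in>free_on (basis F 0). p - ?A v \<in> square_power m I" for p
    proof -
      \<comment> \<open>Surjectivity holds coordinatewise: each coordinate of \<open>p\<close> is
        hit modulo \<open>I\<close>.\<close>
      have "\<forall>r\<in>digits m. \<exists>v. v \<in> free_on (basis F 0) \<and> coeff_part m r p - aug F v \<in> I"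
        using resolution_aug_surj[OF F] by blast
      from bchoice[OF this] obtain w where
        w: "\<forall>r\<in>digits m. w r \<in> free_on (basis F 0) \<and> coeff_part m r p - aug F (w r) \<in> I" ..
      then have "p - ?A (vassemble m w) \<in> square_power m I"
        by (simp add: square_power_iff[OF I] coeff_part_diff A vcoeff_part_vassemble)
      then show ?thesis using vassemble_free_on[of w] w by blast
    qed
    show "base_change m (bdry F 0) ` free_on (basis F (Suc 0)) =
        {v \<in> free_on (basis F 0). ?A v \<in> square_power m I}"
      using base_change_image[OF dm resolution_bdry(2)[OF F, of 0, unfolded syz.simps]]
      by (simp add: square_power_iff[OF I] A)
    show "base_change m (bdry F (Suc i)) ` free_on (basis F (Suc (Suc i))) =
        {v \<in> free_on (basis F (Suc i)). base_change m (bdry F i) v = 0}" for i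
      using base_change_image[OF dm resolution_bdry(2)[OF F, of "Suc i", unfolded syz.simps]]
      by (simp add: base_change_eq_zero_iff[OF dm])
  qed
qed

lemma residue_vsubst_power: "residue (vsubst_power m v) = residue v"
  by (rule poly_mapping_eqI) (simp add: lookup_residue lookup_vsubst_power)

text \<open>Only the exponent 0 is scaled to 0, so the substitution preserves the constant
  coefficients of the matrix.\<close>

lemma tensor_bdry_base_change:
  assumes "graded_free_resolution I F"
  shows "tensor_bdry (base_change_complex F) i v = tensor_bdry F i v"
proof -
  have D: "module_hom smult smult (bdry F i)"
    using graded_homD(1)[OF resolution_bdry(1)[OF assms]] .
  have "module_hom smult smult (base_change m (bdry F i))"
    unfolding base_change_def by (rule module_hom_lin)
  then have "red (base_change m (bdry F i)) v = red (bdry F i) v"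
    by (simp add: red_eq_lin D) (simp add: base_change_def residue_vsubst_power)
  then show ?thesis by (simp add: tensor_bdry_eq_red base_change_complex_def)
qed

lemma tensor_part_base_change:
  "tensor_part (base_change_complex F) i (int m * j) = tensor_part F i j"
  "\<not> int m dvd j \<Longrightarrow> tensor_part (base_change_complex F) i j = {0}"
proof -
  show "tensor_part (base_change_complex F) i (int m * j) = tensor_part F i j"
    using m by (simp add: tensor_part_def base_change_complex_def)
  assume "\<not> int m dvd j"
  then have "{b \<in> basis F i. int m * bdeg F i b = j} = {}" by auto
  then show "tensor_part (base_change_complex F) i j = {0}"
    by (simp only: tensor_part_def base_change_complex_def free_complex.simps) (auto simp: mem_free_on intro: poly_mapping_eqI)
qed

text \<open>Replaces the resolution chosen in \<open>betti\<close> by any given one.\<close>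

lemma betti_eq:
  assumes "homogeneous_ideal I" "graded_free_resolution I F"
  shows "betti I i j = quotient_dim (tor_cycles F i j) (tor_boundaries F i j)"
  unfolding betti_def Let_def
  by (rule tor_dim_unique[OF assms(1) someI[of _ F] assms(2)]) (rule assms(2))

theorem betti_square_power:
  fixes I :: "('n::finite, 'k::field) mpoly set"
  assumes hI: "homogeneous_ideal I"
  shows "betti (square_power m I) i (int m * j) = betti I i j"
    and "\<not> int m dvd j \<Longrightarrow> betti (square_power m I) i j = 0"
proof -
  obtain F where F: "graded_free_resolution I F"
    using graded_free_resolution_exists[OF hI] by blast
  let ?G = "base_change_complex F"
  note G = base_change_resolution[OF homogeneous_ideal_subspace[OF hI] F]
  note hJ = homogeneous_ideal_square_power[OF hI, of m]
  show "betti (square_power m I) i (int m * j) = betti I i j"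
    unfolding betti_eq[OF hJ G] betti_eq[OF hI F]
    by (cases i) (simp_all add: tor_cycles_def tor_boundaries_def tensor_part_base_change
      tensor_bdry_base_change[OF F])
  assume "\<not> int m dvd j"
  then have "tor_cycles ?G i j \<subseteq> {0}"
    using tor_cycles_tensor_part[of ?G i j] by (simp add: tensor_part_base_change)
  define S where "S = (SOME S. complement (tor_cycles ?G i j) (tor_boundaries ?G i j) S)"
  have "complement (tor_cycles ?G i j) (tor_boundaries ?G i j) S"
    unfolding S_def by (rule someI_ex) (intro complement_exists tor_subspaces[OF G])
  \<comment> \<open>A complement inside the zero space is empty, because an independent set does not
    contain 0.\<close>
  then have "S \<subseteq> {0}" "\<not> fm.dependent S"
    using \<open>tor_cycles ?G i j \<subseteq> {0}\<close> by (auto simp: complement_def)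
  then have "S = {}" using fm.dependent_zero[of S] by blast
  then show "betti (square_power m I) i j = 0"
    unfolding betti_eq[OF hJ G] by (simp add: quotient_dim_def S_def complement_def)
qed

end

section \<open>Extremal Betti numbers\<close>

theorem proposition2p11:
  fixes I :: "('n::finite, 'k::field) mpoly set" and m :: nat
  assumes "homogeneous_ideal I" and "m \<ge> 2"
  shows "(\<forall>i j. extremal_betti (square_power m I) i j \<longrightarrow>
            (\<exists>l. j = int m * l \<and> extremal_betti I i l)) \<and>
         (\<forall>i j. extremal_betti I i j \<longrightarrow> extremal_betti (square_power m I) i (int m * j))"
proof -
  have m: "0 < m" using assms(2) by simp
  note b1 = betti_square_power(1)[OF m assms(1)] and b2 = betti_square_power(2)[OF m assms(1)]
  \<comment> \<open>Multiplication by \<open>m > 0\<close> preserves and reflects the order of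
    degrees, and degrees not divisible by \<open>m\<close> carry only zero Betti numbers.\<close>
  have iff: "extremal_betti (square_power m I) i (int m * l) \<longleftrightarrow> extremal_betti I i l" for i l
  proof
    assume e: "extremal_betti (square_power m I) i (int m * l)"
    have "betti I k l' = 0" if "(k, l') \<noteq> (i, l)" "k \<ge> i" "l' \<ge> l" for k l'
    proof -
      have "(k, int m * l') \<noteq> (i, int m * l)" "int m * l' \<ge> int m * l" using that m by auto
      then have "betti (square_power m I) k (int m * l') = 0"
        using e that(2) unfolding extremal_betti_def by simp
      then show ?thesis by (simp add: b1)
    qed
    then show "extremal_betti I i l" using e unfolding extremal_betti_def b1 by simp
  next
    assume e: "extremal_betti I i l"
    have "betti (square_power m I) k l' = 0"
      if "(k, l') \<noteq> (i, int m * l)" "k \<ge> i" "l' \<ge> int m * l" for k l'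
    proof (cases "int m dvd l'")
      case True
      then obtain l'' where l'': "l' = int m * l''" ..
      have "(k, l'') \<noteq> (i, l)" "l'' \<ge> l" using that m by (auto simp: l'')
      then show ?thesis using e that(2) unfolding extremal_betti_def l'' b1 by simp
    next
      case False
      then show ?thesis by (rule b2)
    qed
    then show "extremal_betti (square_power m I) i (int m * l)"
      using e unfolding extremal_betti_def b1 by simp
  qed
  \<comment> \<open>An extremal Betti number is nonzero, which forces \<open>m\<close> to divide its
    degree.\<close>
  have "\<exists>l. j = int m * l" if "extremal_betti (square_power m I) i j" for i j
    using that b2 unfolding extremal_betti_def by (metis dvdE)
  then show ?thesis using iff by blast
qed

end
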